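(* Let $f\in A_+$ and let $\{a_i\}_{i=1}^{\deg f},\{b_j\}_{j=1}^{\deg f}\subset A$ be $f$-dual families. Let $a\in A$ with $\deg a<\deg f$. (i) For every integer $N\ge0$, $\sum_{i=1}^{\deg f}\mathbf e^*(a_i/f)^{q^{N+1}}\,\mathbf e(b_ia/f)=-\Psi_N(a/f)$. (ii) If moreover $a\in A_+$, then $\sum_{i=1}^{\deg f}\mathbf e^*(a_i/f)\,\mathbf e(b_ia/f)^{q^{\deg f-\deg a-1}}=1$.
   Context: $A=\mathbb F_q[T]$, $A_+$ the monic elements, $k_\infty=\mathbb F_q((1/T))$, $|T|_\infty=q$, $\mathbb C_\infty$ the completion of an algebraic closure of $k_\infty$, $\tilde T$ a fixed $(q-1)$-th root of $-T$. $\mathrm{Res}:k_\infty\to\mathbb F_q$, $\sum c_iT^i\mapsto c_{-1}$. Families $\{a_i\},\{b_j\}$ ($i,j=1,\dots,\deg f$) in $A$ are $f$-dual if $\mathrm{Res}(a_ib_j/f)=\delta_{ij}$. Carlitz exponential $\exp_C z=\sum_{n\ge0}z^{q^n}/D_n$, $D_n=\prod_{i=0}^{n-1}(T^{q^n}-T^{q^i})$; $\varpi$ is the element with $\exp_Cz=z\prod_{0\ne a\in A}(1-z/(\varpi a))$ and $|\varpi-\tilde TT|_\infty<|\tilde TT|_\infty$. $\mathbf e(x)=\exp_C(\varpi x)$ for $x\in k_\infty$. Write $\tilde T^{-1}\prod_{i\ge0}(1-t/T^{q^i})=\sum_{i\ge0}\alpha_it^i$ and set $\mathbf e^*(x)=\sum_{i\ge0}\mathrm{Res}(T^ix)\alpha_i$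 for $x\in k_\infty$. For $N\ge0$, $\Psi_N(z)=\prod_{c\in A,\deg c<N}(z-c)\big/\prod_{c\in A_+,\deg c=N}c$. *)

theory Defs
  imports "HOL-Computational_Algebra.Computational_Algebra"
          "HOL-Computational_Algebra.Formal_Laurent_Series"
          "HOL-Library.Cardinality"
begin

text \<open>
  Model.  F_q is a finite field type 'a (q = CARD('a)), A = 'a poly.
  All quantities of the theorem live in the complete subfield
  K = k_infinity(Ttil) of C_infinity, which we model as the Laurent series
  field 'a fls in the uniformizer u = 1/Ttil, with its X-adic topology
  (library metric on fls).  The embedding k_infinity -> K sends 1/T to
  -u^(q-1), i.e. T to kT = - u^(-(q-1)).
\<close>

definition kT :: "'a::{finite,field} fls" where
  "kT = - fls_X_intpow (1 - int (CARD('a)))"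

definition iota :: "'a::{finite,field} poly \<Rightarrow> 'a fls" where
  "iota p = poly (map_poly fls_const p) kT"

text \<open>Res on k_infinity: coefficient of T^(-1).  Since T^(-1) = - u^(q-1)
  and no other power of T contributes to u^(q-1), Res x = - (x $$ (q-1)).\<close>
definition Res :: "'a::{finite,field} fls \<Rightarrow> 'a" where
  "Res x = - fls_nth x (int (CARD('a)) - 1)"

definition f_dual :: "'a::{finite,field} poly \<Rightarrow> (nat \<Rightarrow> 'a poly) \<Rightarrow> (nat \<Rightarrow> 'a poly) \<Rightarrow> bool" where
  "f_dual f as bs \<longleftrightarrow>
     (\<forall>i\<in>{1..degree f}. \<forall>j\<in>{1..degree f}.
        Res (iota (as i * bs j) / iota f) = (if i = j then 1 else 0))"

definition D :: "nat \<Rightarrow> 'a::{finite,field} poly" where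
  "D n = (\<Prod>i<n. [:0,1:] ^ (CARD('a) ^ n) - [:0,1:] ^ (CARD('a) ^ i))"

definition expC :: "'a::{finite,field} fls \<Rightarrow> 'a fls" where
  "expC z = (\<Sum>n. z ^ (CARD('a) ^ n) / iota (D n))"

definition abs_less :: "'a::{finite,field} fls \<Rightarrow> 'a fls \<Rightarrow> bool" where
  "abs_less y z \<longleftrightarrow> y = 0 \<or> (z \<noteq> 0 \<and> fls_subdegree y > fls_subdegree z)"

definition varpi :: "'a::{finite,field} fls \<Rightarrow> 'a fls" where
  "varpi Ttil = (THE w.
     (\<forall>z. ((\<lambda>N. z * (\<Prod>a\<in>{a::'a poly. a \<noteq> 0 \<and> degree a < N}. (1 - z / (w * iota a))))
            \<longlongrightarrow> expC z) sequentially)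
     \<and> abs_less (w - Ttil * kT) (Ttil * kT))"

definition ee :: "'a::{finite,field} fls \<Rightarrow> 'a fls \<Rightarrow> 'a fls" where
  "ee Ttil x = expC (varpi Ttil * x)"

definition alpha_fps :: "'a::{finite,field} fls \<Rightarrow> 'a fls fps" where
  "alpha_fps Ttil = (THE P. \<forall>m.
     ((\<lambda>N. fps_nth (fps_const (inverse Ttil) *
              (\<Prod>i<N. (1 - fps_const (inverse (kT ^ (CARD('a) ^ i))) * fps_X))) m)
        \<longlongrightarrow> fps_nth P m) sequentially)"

definition alpha :: "'a::{finite,field} fls \<Rightarrow> nat \<Rightarrow> 'a fls" where
  "alpha Ttil i = fps_nth (alpha_fps Ttil) i"

definition estar :: "'a::{finite,field} fls \<Rightarrow> 'a fls \<Rightarrow> 'a fls" where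
  "estar Ttil x = (\<Sum>i. fls_const (Res (kT ^ i * x)) * alpha Ttil i)"

text \<open>Psi_N; deg 0 = -infinity, so c = 0 is included in deg c < N.\<close>
definition Psi :: "nat \<Rightarrow> 'a::{finite,field} fls \<Rightarrow> 'a fls" where
  "Psi N z = (\<Prod>c\<in>{c::'a poly. c = 0 \<or> degree c < N}. (z - iota c))
             / (\<Prod>c\<in>{c::'a poly. lead_coeff c = 1 \<and> degree c = N}. iota c)"

end

theory Submission
  imports Defs
begin

text \<open>
  Write \<open>x = a / f\<close>. Since the \<open>b_i\<close> form the basis of \<open>A / f\<close> dual to the \<open>a_i\<close>, both sums equal
  \<open>S m n x = (\<Sum>j. alpha_j^(q^m) * e(T^j x)^(q^n))\<close>, where no dual family occurs.
  The functional equations \<open>e(T x) = T e(x) + e(x)^q\<close> and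
  \<open>alpha_j = alpha_(j-1)^q - T alpha_j^q\<close> give
  \<open>S 0 0 = (S 0 0)^q\<close> and \<open>S 0 n - (S 0 n)^q = (T^(q^n) - T) (S 0 (n-1))^q\<close>.
  Hence, when \<open>x\<close> has order at least \<open>n + 1\<close> at infinity, \<open>S 0 n x\<close> lies in the finite field by
  induction, and its value is read off modulo the maximal ideal; this is (ii).
  For (i), \<open>S (N+1) 0\<close> and \<open>- Psi_N\<close> obey the same recursion under \<open>x \<mapsto> T x mod A\<close>, so their
  difference \<open>h\<close> satisfies \<open>h(T x mod A) = T h(x)\<close> on the finite set \<open>f^(-1) A / A\<close> and vanishes.
  The periodicity of \<open>e\<close> under \<open>A\<close> rests on the product formula for the Carlitz
  exponential, obtained as the limit of the expansions of the polynomials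
  \<open>\<Prod>c. (z - c)\<close> over \<open>deg c < N\<close>.
\<close>

unbundle fps_syntax

section \<open>Valuation and topology on Laurent series\<close>

text \<open>The alpha_j are the coefficients of the reciprocal of the Anderson-Thakur function, and
  their recursion is adjoint to the Carlitz action on e(T^j x): an index shift in the series passes
  from one factor to the other, which is why the sums S m n x close up under Frobenius. The exponent
  in (ii) comes from size. If x has leading term c T^(-n-1), then e(T^n x) is Ttil c up to an
  integral error, and alpha_n times its q^n-th power is c modulo the maximal ideal, while all other
  terms lie in that ideal; for x = a/f this forces n = deg f - deg a - 1. In (i), the constant
  dropped when T x is reduced modulo A is the residue S 0 0 x. This inhomogeneity starts the ladder
  at Psi_0 x = x; the later Psi_N are invariant under constants. Both \<open>varpi\<close> and
  \<open>alpha_fps\<close> are definite descriptions, so nothing can be said about them before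
  existence and uniqueness are known. For the period this needs the whole product formula; the signs
  and powers of T arising there are absorbed through Ttil^q = - T Ttil.\<close>

definition ord_ge :: "int \<Rightarrow> 'a::zero fls \<Rightarrow> bool" where
  "ord_ge k x \<longleftrightarrow> (\<forall>i<k. x $$ i = 0)"

text \<open>\<open>fls_subdegree\<close> has the default value 0 at 0. Bounds phrased by
  \<open>ord_ge\<close>, which 0 satisfies for every \<open>k\<close>, keep the ultrametric
  inequalities free of exceptions.\<close>

lemma ord_ge_iff_subdegree: "ord_ge k x \<longleftrightarrow> x = 0 \<or> k \<le> fls_subdegree x"
  unfolding ord_ge_def
  by (metis fls_eq0_below_subdegree fls_subdegree_geI fls_zero_nth order_less_le_trans)

lemma ord_geD: "ord_ge k x \<Longrightarrow> i < k \<Longrightarrow> x $$ i = 0"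
  by (simp add: ord_ge_def)

lemma ord_ge_mono: "ord_ge k x \<Longrightarrow> l \<le> k \<Longrightarrow> ord_ge l x"
  by (auto simp: ord_ge_def)

lemma ord_ge_zero [simp]: "ord_ge k 0"
  by (simp add: ord_ge_def)

lemma ord_ge_const [simp]: "ord_ge 0 (fls_const c)"
  by (simp add: ord_ge_def)

lemma ord_ge_one [simp]: "ord_ge 0 1"
  by (simp add: ord_ge_def)

lemma ord_ge_add: "ord_ge k x \<Longrightarrow> ord_ge k y \<Longrightarrow> ord_ge k (x + y)"
  for x :: "'a::monoid_add fls"
  by (simp add: ord_ge_def)

lemma ord_ge_minus_iff [simp]: "ord_ge k (- x) \<longleftrightarrow> ord_ge k x" for x :: "'a::group_add fls"
  by (simp add: ord_ge_def)

lemma ord_ge_diff: "ord_ge k x \<Longrightarrow> ord_ge k y \<Longrightarrow> ord_ge k (x - y)"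
  for x :: "'a::group_add fls"
  by (simp add: ord_ge_def)

lemma ord_ge_trans: "ord_ge k (x - y) \<Longrightarrow> ord_ge k (y - z) \<Longrightarrow> ord_ge k (x - z)"
  for x :: "'a::ab_group_add fls"
  using ord_ge_add[of k "x - y" "y - z"] by simp

lemma ord_ge_sym: "ord_ge k (x - y) \<Longrightarrow> ord_ge k (y - x)" for x :: "'a::ab_group_add fls"
  by (simp add: ord_ge_def)

lemma ord_ge_sum: "(\<And>i. i \<in> A \<Longrightarrow> ord_ge k (f i)) \<Longrightarrow> ord_ge k (sum f A)"
  for f :: "_ \<Rightarrow> 'a::comm_monoid_add fls"
  by (induction A rule: infinite_finite_induct) (auto intro: ord_ge_add)

lemma ord_ge_mult: "ord_ge k x \<Longrightarrow> ord_ge l y \<Longrightarrow> m \<le> k + l \<Longrightarrow> ord_ge m (x * y)"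
  for x y :: "'a::semiring_0 fls"
proof (cases "x = 0 \<or> y = 0")
  case False
  then show "ord_ge k x \<Longrightarrow> ord_ge l y \<Longrightarrow> m \<le> k + l \<Longrightarrow> ord_ge m (x * y)"
    by (auto simp: ord_ge_iff_subdegree[of _ x] ord_ge_iff_subdegree[of _ y] ord_ge_def[of m]
             intro!: fls_times_nth_eq0)
qed auto

lemma ord_ge_mult0: "ord_ge 0 x \<Longrightarrow> ord_ge k y \<Longrightarrow> ord_ge k (x * y)"
  for x y :: "'a::semiring_0 fls"
  by (rule ord_ge_mult) auto

lemma ord_ge_power: "ord_ge k x \<Longrightarrow> m \<le> int n * k \<Longrightarrow> ord_ge m (x ^ n)"
  for x :: "'a::semiring_1 fls"
proof (induction n arbitrary: m)
  case (Suc n)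
  show ?case unfolding power_Suc
    by (rule ord_ge_mult[OF Suc.prems(1) Suc.IH[OF Suc.prems(1) order_refl]])
       (use Suc.prems in \<open>simp add: algebra_simps\<close>)
qed (auto intro: ord_ge_mono[OF ord_ge_one])

lemma ord_ge_inverse: "fls_subdegree x \<le> - k \<Longrightarrow> ord_ge k (inverse x)"
  for x :: "'a::field fls"
  by (cases "x = 0") (auto simp: ord_ge_iff_subdegree)

lemma dist_fls_less_iff:
  "dist x y < inverse (2 ^ k) \<longleftrightarrow> ord_ge (int k + 1) (x - y)" for x y :: "'a::group_add fls"
proof -
  consider "x = y" | "x \<noteq> y" "fls_subdegree (x - y) \<ge> 0" | "x \<noteq> y" "fls_subdegree (x - y) < 0"
    by linarith
  then show ?thesis
  proof cases
    case 3
    have "inverse (2 ^ k) \<le> (1::real)" by (simp add: inverse_le_1_iff)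
    also have "1 \<le> (2::real) ^ nat (- fls_subdegree (x - y))" by simp
    finally show ?thesis using 3 by (simp add: dist_fls_def ord_ge_iff_subdegree)
  qed (auto simp: dist_fls_def ord_ge_iff_subdegree)
qed

text \<open>Balls of radius 2^(-k) are described by orders above k, so every later limit becomes a
  statement about orders.\<close>

lemma tendsto_fls_iff:
  "(X \<longlongrightarrow> L) F \<longleftrightarrow> (\<forall>k. eventually (\<lambda>n. ord_ge k (X n - L)) F)" for L :: "'a::group_add fls"
proof
  assume L: "(X \<longlongrightarrow> L) F"
  show "\<forall>k. eventually (\<lambda>n. ord_ge k (X n - L)) F"
  proof
    fix k
    have "eventually (\<lambda>n. dist (X n) L < inverse (2 ^ nat k)) F"
      using L by (rule tendstoD) simp
    then show "eventually (\<lambda>n. ord_ge k (X n - L)) F"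
      by eventually_elim (auto simp: dist_fls_less_iff elim: ord_ge_mono)
  qed
next
  assume *: "\<forall>k. eventually (\<lambda>n. ord_ge k (X n - L)) F"
  show "(X \<longlongrightarrow> L) F"
  proof (rule tendstoI)
    fix e :: real assume "e > 0"
    then obtain k where k: "inverse (2 ^ k) < e"
      using reals_power_lt_ex[of e 2] by (auto simp: field_simps)
    show "eventually (\<lambda>n. dist (X n) L < e) F"
      using *[rule_format, of "int k + 1"]
      by eventually_elim (use k in \<open>auto simp flip: dist_fls_less_iff\<close>)
  qed
qed

lemma tendsto_fls_id: "eventually (\<lambda>x. ord_ge k (x - a)) (nhds a)" for a :: "'a::group_add fls"
  using tendsto_fls_iff[of "\<lambda>x. x" a "nhds a"] by (simp add: tendsto_def eventually_nhds) blast

instance fls :: (ab_group_add) topological_ab_group_add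
proof
  fix a b :: "'a fls"
  show "((\<lambda>x. fst x + snd x) \<longlongrightarrow> a + b) (nhds a \<times>\<^sub>F nhds b)"
    unfolding tendsto_fls_iff
  proof
    fix k
    have "eventually (\<lambda>x. ord_ge k (fst x - a) \<and> ord_ge k (snd x - b)) (nhds a \<times>\<^sub>F nhds b)"
      by (intro eventually_prodI tendsto_fls_id)
    then show "eventually (\<lambda>x. ord_ge k (fst x + snd x - (a + b))) (nhds a \<times>\<^sub>F nhds b)"
      by eventually_elim (auto simp: add_diff_add intro: ord_ge_add)
  qed
  show "(uminus \<longlongrightarrow> - a) (nhds a)"
    unfolding tendsto_fls_iff
  proof
    fix k
    show "eventually (\<lambda>x. ord_ge k (- x - - a)) (nhds a)"
      using tendsto_fls_id[of k a] by eventually_elim (simp add: ord_ge_def)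
  qed
qed

instance fls :: (ring) topological_semigroup_mult
proof
  fix a b :: "'a fls"
  show "((\<lambda>x. fst x * snd x) \<longlongrightarrow> a * b) (nhds a \<times>\<^sub>F nhds b)"
    unfolding tendsto_fls_iff
  proof
    fix k
    define s where "s = min 0 (min (fls_subdegree a) (fls_subdegree b))"
    have s: "ord_ge s a" "ord_ge s b" "s \<le> 0" by (auto simp: s_def ord_ge_iff_subdegree)
    have "eventually (\<lambda>x. ord_ge (max 0 (k - s)) (fst x - a) \<and> ord_ge (max 0 (k - s)) (snd x - b))
            (nhds a \<times>\<^sub>F nhds b)"
      by (intro eventually_prodI tendsto_fls_id)
    then show "eventually (\<lambda>x. ord_ge k (fst x * snd x - a * b)) (nhds a \<times>\<^sub>F nhds b)"
    proof eventually_elim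
      case (elim x)
      \<comment> \<open>The mixed terms lose at most \<open>- s\<close>, where \<open>s\<close>
        bounds the poles of \<open>a\<close> and \<open>b\<close>; hence the precision
        \<open>max 0 (k - s)\<close> asked of both factors.\<close>
      have eq: "fst x * snd x - a * b = (fst x - a) * (snd x - b) + (fst x - a) * b + a * (snd x - b)"
        by (simp add: algebra_simps)
      define m where "m = max 0 (k - s)"
      from elim have m: "ord_ge m (fst x - a)" "ord_ge m (snd x - b)" by (simp_all add: m_def)
      have "k \<le> m + m" "k \<le> m + s" "k \<le> s + m" using s by (auto simp: m_def max_def)
      with m s show ?case unfolding eq
        by (intro ord_ge_add) (auto intro: ord_ge_mult)
    qed
  qed
qed

instance fls :: (ring_1) topological_monoid_mult ..

lemma tendsto_fls_power: "(X \<longlongrightarrow> L) F \<Longrightarrow> ((\<lambda>n. X n ^ k) \<longlongrightarrow> L ^ k) F" for L :: "'a::ring_1 fls"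
  by (induction k) (auto intro: tendsto_mult)

text \<open>By the ultrametric inequality, consecutive differences suffice. Each coefficient is
  eventually constant, and these constants form the limit.\<close>

lemma fls_Cauchy_convergent:
  fixes X :: "nat \<Rightarrow> 'a::ab_group_add fls"
  assumes X: "\<And>k. eventually (\<lambda>n. ord_ge k (X (Suc n) - X n)) sequentially"
  obtains L where "X \<longlonglongrightarrow> L"
proof -
  from X have "\<exists>N. \<forall>n\<ge>N. ord_ge k (X (Suc n) - X n)" for k
    by (simp add: eventually_sequentially)
  then obtain N where N: "\<And>k n. n \<ge> N k \<Longrightarrow> ord_ge k (X (Suc n) - X n)" by metis
  have N': "ord_ge k (X n - X m)" if "N k \<le> m" "m \<le> n" for k m n
    using that(2)
  proof (induction n rule: dec_induct)
    case (step n)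
    show ?case by (rule ord_ge_trans[OF N step.IH]) (use step that in simp)
  qed simp
  have coeff: "X m $$ i = X n $$ i" if "N k \<le> m" "N k \<le> n" "i < k" for i k m n
    using N'[of k m n] N'[of k n m] that by (cases "m \<le> n") (auto dest!: ord_geD[of _ _ i])
  define c where "c i = X (N (i + 1)) $$ i" for i
  have c: "c i = X n $$ i" if "N k \<le> n" "i < k" for i k n
  proof -
    have "c i = X (max (N (i + 1)) n) $$ i"
      unfolding c_def by (rule coeff[of "i + 1"]) auto
    also have "\<dots> = X n $$ i" by (rule coeff[of k]) (use that in auto)
    finally show ?thesis .
  qed
  \<comment> \<open>From \<open>N 0\<close> on all terms agree in negative degrees, so the family of
    coefficients is bounded below and defines a Laurent series.\<close>
  have "c i = 0" if "i < min 0 (fls_subdegree (X (N 0)))" for i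
    using c[of 0 "N 0" i] that by simp
  then have nth: "Abs_fls c $$ i = c i" for i
    by (subst nth_Abs_fls_lower_bound[of "min 0 (fls_subdegree (X (N 0)))"]) auto
  have "X \<longlonglongrightarrow> Abs_fls c"
    unfolding tendsto_fls_iff
  proof
    fix k
    show "eventually (\<lambda>n. ord_ge k (X n - Abs_fls c)) sequentially"
      using eventually_ge_at_top[of "N k"]
      by eventually_elim (simp add: ord_ge_def nth c[of k])
  qed
  then show thesis by (rule that)
qed

lemma summable_fls:
  fixes f :: "nat \<Rightarrow> 'a::ab_group_add fls"
  assumes "\<And>k. eventually (\<lambda>n. ord_ge k (f n)) sequentially"
  shows "summable f"
proof -
  obtain L where "(\<lambda>n. \<Sum>i<n. f i) \<longlonglongrightarrow> L"
    by (rule fls_Cauchy_convergent[of "\<lambda>n. \<Sum>i<n. f i"]) (use assms in simp)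
  then show ?thesis by (auto simp: summable_def sums_def)
qed

lemma ord_ge_tendsto:
  fixes X :: "'b \<Rightarrow> 'a::ab_group_add fls"
  assumes "(X \<longlongrightarrow> L) F" "F \<noteq> bot" "eventually (\<lambda>n. ord_ge k (X n - y)) F"
  shows "ord_ge k (L - y)"
proof -
  have "eventually (\<lambda>n. ord_ge k (X n - L)) F" using assms(1) by (simp add: tendsto_fls_iff)
  with assms(3) have "eventually (\<lambda>n. ord_ge k (L - y)) F"
    by eventually_elim (metis ord_ge_trans ord_ge_sym)
  with assms(2) show ?thesis by simp
qed

lemma ord_ge_sums:
  fixes f :: "nat \<Rightarrow> 'a::ab_group_add fls"
  assumes "f sums s" "\<And>n. ord_ge k (f n)"
  shows "ord_ge k s"
proof -
  have "ord_ge k (s - 0)"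
    by (rule ord_ge_tendsto[of "\<lambda>n. \<Sum>i<n. f i" s sequentially])
       (use assms in \<open>auto simp: sums_def intro!: ord_ge_sum always_eventually\<close>)
  then show ?thesis by simp
qed

lemma sums_fls_mult: "f sums s \<Longrightarrow> (\<lambda>n. c * f n) sums (c * s)" for c :: "'a::ring fls"
  unfolding sums_def by (simp flip: sum_distrib_left add: tendsto_mult)

lemma sums_fls_diff: "f sums s \<Longrightarrow> g sums t \<Longrightarrow> (\<lambda>n. f n - g n) sums (s - t)"
  for s :: "'a::ab_group_add fls"
  unfolding sums_def by (simp add: sum_subtractf tendsto_diff)

lemma subdegree_principal_unit:
  fixes x :: "'a::zero_neq_one fls"
  assumes "x $$ 0 = 1" "ord_ge 0 x"
  shows "fls_subdegree x = 0"
  using assms by (intro fls_subdegree_eqI) (auto simp: ord_ge_def)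

text \<open>Dominated convergence: the tail is small uniformly in \<open>N\<close> because the
  weights are integral, and on the remaining finitely many indices the weights tend to 1. It serves
  to pass to the limit in the expanded Carlitz product.\<close>

lemma tendsto_fls_weighted_sum:
  fixes t :: "nat \<Rightarrow> 'a::ring_1 fls"
  assumes t: "\<And>k. eventually (\<lambda>n. ord_ge k (t n)) sequentially" and sums: "t sums s"
    and g1: "\<And>i. (\<lambda>N. g N i) \<longlonglongrightarrow> 1" and g0: "\<And>N i. i \<le> N \<Longrightarrow> ord_ge 0 (g N i)"
  shows "(\<lambda>N. \<Sum>i\<le>N. g N i * t i) \<longlonglongrightarrow> s"
proof -
  have "(\<lambda>N. \<Sum>i\<le>N. (g N i - 1) * t i) \<longlonglongrightarrow> 0"
    unfolding tendsto_fls_iff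
  proof
    fix k
    obtain I where I: "\<And>i. i \<ge> I \<Longrightarrow> ord_ge k (t i)"
      using t[of k] by (auto simp: eventually_sequentially)
    have "((\<lambda>N. \<Sum>i<I. (g N i - 1) * t i) \<longlongrightarrow> (\<Sum>i<I. (1 - 1) * t i)) sequentially"
      by (intro tendsto_intros g1)
    then have "eventually (\<lambda>N. ord_ge k ((\<Sum>i<I. (g N i - 1) * t i) - 0)) sequentially"
      unfolding tendsto_fls_iff by simp
    with eventually_ge_at_top[of I]
    show "eventually (\<lambda>N. ord_ge k ((\<Sum>i\<le>N. (g N i - 1) * t i) - 0)) sequentially"
    proof eventually_elim
      case (elim N)
      have split: "{..N} = {..<I} \<union> {I..N}" using elim(1) by auto
      have "(\<Sum>i\<le>N. (g N i - 1) * t i) = (\<Sum>i<I. (g N i - 1) * t i) + (\<Sum>i=I..N. (g N i - 1) * t i)"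
        unfolding split by (rule sum.union_disjoint) auto
      then show ?case
        using elim(2) by (auto intro!: ord_ge_add ord_ge_sum ord_ge_mult0 ord_ge_diff g0 I)
    qed
  qed
  moreover have "(\<lambda>N. \<Sum>i\<le>N. t i) \<longlonglongrightarrow> s"
    using sums by (simp add: sums_def' atMost_atLeast0)
  ultimately show ?thesis
    using tendsto_add by (fastforce simp: left_diff_distrib sum_subtractf)
qed

section \<open>Frobenius\<close>

lemma card_gt_1: "CARD('a::{finite,field}) > 1"
proof -
  have "card {0, 1 :: 'a} \<le> CARD('a)" by (rule card_mono) auto
  then show ?thesis by simp
qed

lemma finite_field_power_card: "x ^ CARD('a) = x" for x :: "'a::{finite,field}"
proof (cases "x = 0")
  case False
  let ?U = "UNIV - {0 :: 'a}"
  have "\<Prod>?U = (\<Prod>y\<in>?U. x * y)"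
    by (rule prod.reindex_bij_witness[of _ "\<lambda>y. x * y" "\<lambda>y. y / x"]) (use False in auto)
  also have "\<dots> = x ^ (CARD('a) - 1) * \<Prod>?U"
    by (simp add: prod.distrib)
  finally have "x ^ (CARD('a) - 1) = 1" by simp
  then have "x * x ^ (CARD('a) - 1) = x" by simp
  then show ?thesis by (metis card_gt_1 One_nat_def less_imp_Suc_add power_Suc diff_Suc_1 plus_1_eq_Suc)
qed (use card_gt_1 in simp)

lemma finite_field_power_card_power: "x ^ (CARD('a) ^ n) = x" for x :: "'a::{finite,field}"
  by (induction n) (simp_all add: power_mult finite_field_power_card mult.commute)

text \<open>
  The polynomial \<open>(X + 1)^q - X^q - 1\<close> has degree less than \<open>q\<close> and vanishes on the field with
  \<open>q\<close> elements, so it is zero; this avoids showing that \<open>q\<close> is a power of the characteristic.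
\<close>

lemma of_nat_card_choose_eq_0:
  assumes "0 < k" "k < CARD('a::{finite,field})"
  shows "of_nat (CARD('a) choose k) = (0 :: 'a)"
proof -
  let ?q = "CARD('a)"
  let ?P = "\<Sum>k\<le>?q. monom (of_nat (?q choose k)) k :: 'a poly"
  let ?Q = "1 + monom 1 ?q :: 'a poly"
  have coeff: "coeff ?P i = of_nat (?q choose i)" for i
    by (cases "i \<le> ?q") (simp_all add: coeff_sum binomial_eq_0)
  have "?P = ?Q"
  proof (rule poly_eqI_degree_lead_coeff[where A = UNIV and n = ?q])
    show "coeff ?P ?q = coeff ?Q ?q" using card_gt_1[where 'a = 'a] by (simp add: coeff)
    show "degree ?P \<le> ?q" by (rule degree_sum_le) (auto intro: order_trans[OF degree_monom_le])
    show "degree ?Q \<le> ?q" by (auto intro!: degree_add_le degree_monom_le)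
    fix z :: 'a
    have "poly ?P z = (z + 1) ^ ?q"
      by (simp add: poly_sum poly_monom binomial_ring)
    then show "poly ?P z = poly ?Q z"
      by (simp add: poly_monom finite_field_power_card)
  qed auto
  then have "coeff ?P k = coeff ?Q k" by simp
  with assms show ?thesis by (simp only: coeff) simp
qed

lemma frob_add: "(x + y) ^ CARD('a) = x ^ CARD('a) + y ^ CARD('a)"
  for x y :: "'a::{finite,field} fls"
proof -
  let ?q = "CARD('a)"
  let ?t = "\<lambda>k. of_nat (?q choose k) * x ^ k * y ^ (?q - k)"
  have "(x + y) ^ ?q = (\<Sum>k\<le>?q. ?t k)" by (rule binomial_ring)
  also have "\<dots> = (\<Sum>k\<in>{0, ?q}. ?t k)"
    by (rule sum.mono_neutral_right)
       (auto simp: fls_of_nat of_nat_card_choose_eq_0)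
  finally show ?thesis using card_gt_1[where 'a = 'a] by simp
qed

lemma frob_add_pow: "(x + y) ^ (CARD('a) ^ n) = x ^ (CARD('a) ^ n) + y ^ (CARD('a) ^ n)"
  for x y :: "'a::{finite,field} fls"
proof (induction n)
  case (Suc n)
  then show ?case by (simp only: power_Suc2 power_mult frob_add)
qed simp

lemma frob_minus_pow: "(- x) ^ (CARD('a) ^ n) = - (x ^ (CARD('a) ^ n))" for x :: "'a::{finite,field} fls"
  using frob_add_pow[of "- x" x n] card_gt_1[where 'a = 'a]
  by (simp add: eq_neg_iff_add_eq_0 zero_power)

lemma frob_diff_pow: "(x - y) ^ (CARD('a) ^ n) = x ^ (CARD('a) ^ n) - y ^ (CARD('a) ^ n)"
  for x y :: "'a::{finite,field} fls"
  using frob_add_pow[of x "- y" n] by (simp add: frob_minus_pow)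

lemmas frob_minus = frob_minus_pow[where n = 1, simplified]
lemmas frob_diff = frob_diff_pow[where n = 1, simplified]

lemma frob_sum_pow: "(\<Sum>i\<in>A. f i) ^ (CARD('a) ^ n) = (\<Sum>i\<in>A. f i ^ (CARD('a) ^ n))"
  for f :: "_ \<Rightarrow> 'a::{finite,field} fls"
  by (induction A rule: infinite_finite_induct) (auto simp: frob_add_pow)

lemmas frob_sum = frob_sum_pow[where n = 1, simplified]

lemma frob_const_pow: "fls_const c ^ (CARD('a) ^ n) = fls_const c" for c :: "'a::{finite,field}"
  by (simp add: finite_field_power_card_power flip: fls_const_power)

lemmas frob_const = frob_const_pow[where n = 1, simplified]

lemma frob_neg_one_power: "((- 1) ^ i) ^ CARD('a) = ((- 1) ^ i :: 'a::{finite,field} fls)"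
  using frob_minus[of 1] by (metis power_one power_mult mult.commute)

lemma sums_frob:
  fixes f :: "nat \<Rightarrow> 'a::{finite,field} fls"
  assumes "f sums s" shows "(\<lambda>n. f n ^ (CARD('a) ^ k)) sums s ^ (CARD('a) ^ k)"
  using tendsto_fls_power[of "\<lambda>n. \<Sum>i<n. f i" s sequentially "CARD('a) ^ k"] assms
  by (simp add: sums_def frob_sum_pow)

text \<open>Both sides have degree at most q, the same coefficient at q and the same values at the q
  constants.\<close>

lemma prod_poly_roots_const:
  "(\<Prod>\<epsilon>\<in>UNIV. [:- fls_const \<epsilon>, 1:]) =
     monom 1 (CARD('a)) - (monom 1 1 :: 'a::{finite,field} fls poly)" (is "?P = ?Q")
proof (rule poly_eqI_degree_lead_coeff[where A = "range fls_const" and n = "CARD('a)"])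
  have deg: "degree ?P = CARD('a)"
    by (subst degree_prod_eq_sum_degree) auto
  have "lead_coeff ?P = 1"
    by (simp add: lead_coeff_prod)
  then show "coeff ?P CARD('a) = coeff ?Q CARD('a)"
    using card_gt_1[where 'a = 'a] by (simp add: deg)
  show "degree ?P \<le> CARD('a)" by (simp add: deg)
  show "degree ?Q \<le> CARD('a)"
    using card_gt_1[where 'a = 'a]
    by (intro degree_diff_le) (auto intro: order_trans[OF degree_monom_le])
  have "inj (fls_const :: 'a \<Rightarrow> 'a fls)" by (metis fls_const_nth injI)
  then show "CARD('a) \<le> card (range (fls_const :: 'a \<Rightarrow> 'a fls))"
    by (simp add: card_image)
  fix z :: "'a fls" assume "z \<in> range fls_const"
  then obtain c where c: "z = fls_const c" by auto
  then have "poly ?P z = 0" by (auto simp: poly_prod intro!: bexI[of _ c])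
  then show "poly ?P z = poly ?Q z" by (simp add: poly_monom c frob_const)
qed

text \<open>The homogenised factorisation of z^q - z. With y = e_N(T^N) it drives the recursion of
  the Carlitz polynomials; with y = 1 it shows that elements fixed by Frobenius are
  constants.\<close>

lemma prod_diff_const_mult:
  "(\<Prod>\<epsilon>\<in>UNIV. (z - fls_const \<epsilon> * y)) = z ^ CARD('a) - y ^ (CARD('a) - 1) * z"
  for z y :: "'a::{finite,field} fls"
proof (cases "y = 0")
  case False
  let ?q = "CARD('a)"
  have "(\<Prod>\<epsilon>\<in>UNIV. (z - fls_const \<epsilon> * y)) = (\<Prod>\<epsilon>\<in>UNIV. y * (z / y - fls_const \<epsilon>))"
    using False by (intro prod.cong) (simp_all add: right_diff_distrib mult.commute)
  also have "\<dots> = y ^ ?q * (\<Prod>\<epsilon>\<in>UNIV. (z / y - fls_const \<epsilon>))"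
    by (simp add: prod.distrib)
  also have "(\<Prod>\<epsilon>\<in>UNIV. (z / y - fls_const \<epsilon>)) = (z / y) ^ ?q - z / y"
    using arg_cong[OF prod_poly_roots_const, of "\<lambda>p. poly p (z / y)"]
    by (simp add: poly_prod poly_monom)
  also have "y ^ ?q * ((z / y) ^ ?q - z / y) = z ^ ?q - y ^ (?q - 1) * z"
    using False by (simp add: field_simps power_diff)
  finally show ?thesis .
qed (use card_gt_1[where 'a = 'a] in simp)

text \<open>Wilson's theorem for F_q: cancel the factor X in X^q - X and evaluate the rest at
  0.\<close>

lemma prod_minus_nonzero_const:
  "(\<Prod>\<epsilon>\<in>UNIV - {0}. - fls_const \<epsilon>) = (- 1 :: 'a::{finite,field} fls)"
proof -
  let ?q = "CARD('a)"
  have "[:0, 1:] * (\<Prod>\<epsilon>\<in>UNIV - {0}. [:- fls_const \<epsilon>, 1:]) =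
        [:0, 1:] * (monom 1 (?q - 1) - (1 :: 'a fls poly))"
  proof -
    obtain m where m: "?q = Suc m" using card_gt_1[where 'a = 'a] by (metis not0_implies_Suc not_less0)
    have "(\<Prod>\<epsilon>\<in>UNIV. [:- fls_const \<epsilon>, 1:]) =
          [:0, 1:] * (\<Prod>\<epsilon>\<in>UNIV - {0}. [:- fls_const \<epsilon>, 1:] :: 'a fls poly)"
      by (subst prod.remove[of _ 0]) simp_all
    then show ?thesis
      unfolding prod_poly_roots_const m by (simp add: monom_Suc diff_pCons one_pCons monom_0)
  qed
  then have "(\<Prod>\<epsilon>\<in>UNIV - {0}. [:- fls_const \<epsilon>, 1:]) = (monom 1 (?q - 1) - (1 :: 'a fls poly))"
    by (simp only: mult_cancel_left) auto
  then have "poly (\<Prod>\<epsilon>\<in>UNIV - {0}. [:- fls_const \<epsilon>, 1:]) 0 =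
             poly (monom 1 (?q - 1) - (1 :: 'a fls poly)) 0"
    by simp
  then show ?thesis using card_gt_1[where 'a = 'a] by (simp add: poly_prod poly_monom)
qed

lemma frob_fixed_imp_const:
  fixes z :: "'a::{finite,field} fls"
  assumes "z ^ CARD('a) = z"
  obtains c where "z = fls_const c"
  using prod_diff_const_mult[of z 1] assms that by auto

section \<open>The embedding of the polynomial ring\<close>

lemma kT_nonzero [simp]: "kT \<noteq> 0"
  by (simp add: kT_def fls_shift_eq0_iff)

lemma subdegree_kT [simp]: "fls_subdegree (kT :: 'a::{finite,field} fls) = 1 - int CARD('a)"
  by (simp add: kT_def)

lemma subdegree_kT_power [simp]:
  "fls_subdegree (kT ^ n :: 'a::{finite,field} fls) = int n * (1 - int CARD('a))"
  by (simp add: fls_subdegree_pow)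

lemma ord_ge_kT_power: "k \<le> int n * (1 - int CARD('a)) \<Longrightarrow> ord_ge k (kT ^ n :: 'a::{finite,field} fls)"
  by (simp add: ord_ge_iff_subdegree)

lemma inverse_kT_frob:
  "inverse (kT ^ (CARD('a) ^ i)) = - (fls_X ^ ((CARD('a) - 1) * CARD('a) ^ i) :: 'a::{finite,field} fls)"
proof -
  have "kT * - (fls_X ^ (CARD('a) - 1)) = (1 :: 'a fls)"
    using card_gt_1[where 'a = 'a]
    by (simp add: kT_def fls_X_power_conv_shift_1 fls_times_both_shifted_simp of_nat_diff)
  then have "(kT * - (fls_X ^ (CARD('a) - 1))) ^ (CARD('a) ^ i) = (1 :: 'a fls)" by simp
  then have "kT ^ (CARD('a) ^ i) * - (fls_X ^ ((CARD('a) - 1) * CARD('a) ^ i)) = (1 :: 'a fls)"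
    by (simp only: power_mult_distrib frob_minus_pow power_mult)
  then show ?thesis by (rule inverse_unique)
qed

lemma iota_altdef: "iota p = (\<Sum>i\<le>degree p. fls_const (coeff p i) * kT ^ i)"
  by (simp add: iota_def poly_altdef degree_map_poly coeff_map_poly)

lemma iota_0 [simp]: "iota 0 = 0"
  by (simp add: iota_def)

lemma iota_pCons: "iota (pCons c p) = fls_const c + kT * iota p"
  by (simp add: iota_def map_poly_pCons)

lemma iota_add [simp]: "iota (p + r) = iota p + iota r"
  by (induction p r rule: poly_induct2)
     (simp_all add: iota_pCons algebra_simps flip: fls_plus_const)

lemma iota_smult [simp]: "iota (smult c p) = fls_const c * iota p"
  by (induction p) (simp_all add: iota_pCons algebra_simps flip: fls_const_mult_const)

lemma iota_mult [simp]: "iota (p * r) = iota p * iota r"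
  by (induction p) (simp_all add: iota_pCons algebra_simps)

lemma iota_minus [simp]: "iota (- p) = - iota p"
  using iota_add[of p "- p"] by (simp add: eq_neg_iff_add_eq_0 add.commute)

lemma iota_diff [simp]: "iota (p - r) = iota p - iota r"
  using iota_add[of p "- r"] by simp

lemma iota_const: "iota [:c:] = fls_const c"
  by (simp add: iota_pCons)

lemma iota_1 [simp]: "iota 1 = 1"
  by (simp add: one_pCons iota_const)

lemma iota_power [simp]: "iota (p ^ n) = iota p ^ n"
  by (induction n) simp_all

lemma iota_X [simp]: "iota [:0, 1:] = kT"
  by (simp add: iota_pCons)

lemma iota_monom [simp]: "iota (monom c n) = fls_const c * kT ^ n"
  by (induction n) (simp_all add: iota_pCons monom_0 monom_Suc algebra_simps)

lemma iota_sum [simp]: "iota (\<Sum>i\<in>A. g i) = (\<Sum>i\<in>A. iota (g i))"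
  by (induction A rule: infinite_finite_induct) simp_all

lemma iota_prod [simp]: "iota (\<Prod>i\<in>A. g i) = (\<Prod>i\<in>A. iota (g i))"
  by (induction A rule: infinite_finite_induct) simp_all

lemma ord_ge_iota:
  fixes p :: "'a::{finite,field} poly"
  assumes "degree p \<le> n" shows "ord_ge (int n * (1 - int CARD('a))) (iota p)"
  unfolding iota_altdef
proof (rule ord_ge_sum)
  fix i assume "i \<in> {..degree p}"
  then have "int i \<le> int n" using assms by simp
  then show "ord_ge (int n * (1 - int CARD('a))) (fls_const (coeff p i) * kT ^ i)"
    by (intro ord_ge_mult0 ord_ge_kT_power mult_right_mono_neg) auto
qed

lemma ord_ge_iota_minus_lead:
  fixes p :: "'a::{finite,field} poly"
  assumes "degree p \<le> n"
  shows "ord_ge ((int n - 1) * (1 - int CARD('a))) (iota p - fls_const (coeff p n) * kT ^ n)"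
proof (cases n)
  case 0
  then show ?thesis using assms by (auto elim!: degree_eq_zeroE simp: iota_const)
next
  case (Suc m)
  have "degree (p - monom (coeff p n) n) \<le> m"
    using assms Suc by (intro degree_le) (auto simp: not_less intro!: coeff_eq_0 le_less_Suc_eq)
  from ord_ge_iota[OF this] show ?thesis by (simp add: Suc)
qed

lemma subdegree_iota:
  fixes p :: "'a::{finite,field} poly"
  assumes "p \<noteq> 0"
  shows "fls_subdegree (iota p) = int (degree p) * (1 - int CARD('a))"
proof (rule fls_subdegree_eqI)
  let ?m = "int (degree p) * (1 - int CARD('a))"
  show "iota p $$ i = 0" if "i < ?m" for i
    using ord_ge_iota[of p "degree p"] that by (auto simp: ord_ge_def)
  have "(iota p - fls_const (lead_coeff p) * kT ^ degree p) $$ ?m = 0"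
    by (rule ord_geD[OF ord_ge_iota_minus_lead])
       (use card_gt_1[where 'a = 'a] in \<open>auto simp: algebra_simps\<close>)
  moreover have "(kT ^ degree p :: 'a fls) $$ ?m \<noteq> 0"
    using nth_fls_subdegree_nonzero[of "kT ^ degree p :: 'a fls"] by simp
  ultimately show "iota p $$ ?m \<noteq> 0"
    using assms by simp
qed

lemma iota_eq_0_iff [simp]: "iota p = 0 \<longleftrightarrow> p = 0" for p :: "'a::{finite,field} poly"
proof
  assume *: "iota p = 0"
  show "p = 0"
  proof (rule ccontr)
    \<comment> \<open>Since \<open>fls_subdegree 0 = 0\<close>, the subdegree cannot tell a nonzero
      constant from 0; a factor T first makes the degree positive.\<close>
    assume "p \<noteq> 0"
    then have "[:0, 1:] * p \<noteq> 0" "degree ([:0, 1:] * p) = Suc (degree p)"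
      by (simp_all add: degree_mult_eq)
    with subdegree_iota[of "[:0, 1:] * p"] * card_gt_1[where 'a = 'a] show False
      by (simp add: iota_pCons)
  qed
qed simp

section \<open>Polynomials of bounded degree\<close>

definition polys_below :: "nat \<Rightarrow> 'a::zero poly set" where
  "polys_below N = {c. c = 0 \<or> degree c < N}"

lemma polys_below_0 [simp]: "polys_below 0 = {0}"
  by (auto simp: polys_below_def)

lemma zero_in_polys_below [simp]: "0 \<in> polys_below N"
  by (simp add: polys_below_def)

lemma polys_below_iff: "c \<in> polys_below N \<longleftrightarrow> (\<forall>i\<ge>N. coeff c i = 0)"
proof
  assume *: "\<forall>i\<ge>N. coeff c i = 0"
  show "c \<in> polys_below N"
    using * leading_coeff_0_iff[of c] by (auto simp: polys_below_def not_less[symmetric])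
qed (auto simp: polys_below_def intro: coeff_eq_0)

lemma polys_below_add: "c \<in> polys_below N \<Longrightarrow> c' \<in> polys_below N \<Longrightarrow> c + c' \<in> polys_below N"
  for c :: "'a::comm_monoid_add poly"
  by (simp add: polys_below_iff)

lemma polys_below_diff: "c \<in> polys_below N \<Longrightarrow> c' \<in> polys_below N \<Longrightarrow> c - c' \<in> polys_below N"
  for c :: "'a::ab_group_add poly"
  by (simp add: polys_below_iff)

text \<open>Splitting off the coefficient of T^N is the source of every recursion in N for products
  over polynomials of bounded degree.\<close>

lemma polys_below_Suc:
  "polys_below (Suc N) = (\<lambda>(\<epsilon>, c). monom \<epsilon> N + c :: 'a::ab_group_add poly) ` (UNIV \<times> polys_below N)"
proof -
  have "c \<in> (\<lambda>(\<epsilon>, c). monom \<epsilon> N + c) ` (UNIV \<times> polys_below N)" if "c \<in> polys_below (Suc N)"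
    for c :: "'a poly"
    by (rule image_eqI[of _ _ "(coeff c N, c - monom (coeff c N) N)"])
       (use that in \<open>auto simp: polys_below_iff Suc_le_eq le_less[of N]\<close>)
  moreover have "monom e N + c \<in> polys_below (Suc N)" if "c \<in> polys_below N" for e and c :: "'a poly"
    using that by (simp add: polys_below_iff)
  ultimately show ?thesis by auto
qed

lemma inj_on_polys_below_Suc:
  "inj_on (\<lambda>(\<epsilon>, c). monom \<epsilon> N + c :: 'a::ab_group_add poly) (UNIV \<times> polys_below N)"
proof (rule inj_onI, clarify)
  fix e e' :: 'a and c c' :: "'a poly"
  assume c: "c \<in> polys_below N" "c' \<in> polys_below N" and eq: "monom e N + c = monom e' N + c'"
  have "e = e'" using arg_cong[OF eq, of "\<lambda>p. coeff p N"] c by (simp add: polys_below_iff)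
  with eq show "e = e' \<and> c = c'" by simp
qed

lemma card_polys_below:
  "finite (polys_below N :: 'a::{finite,ab_group_add} poly set) \<and>
   card (polys_below N :: 'a poly set) = CARD('a) ^ N"
  by (induction N) (simp_all add: polys_below_Suc card_image[OF inj_on_polys_below_Suc] card_cartesian_product)

lemma finite_polys_below [simp]: "finite (polys_below N :: 'a::{finite,ab_group_add} poly set)"
  using card_polys_below by blast

section \<open>Carlitz polynomials\<close>

text \<open>Carlitz's polynomial e_N, the numerator of \<open>Psi N\<close>. The brackets and
  products defined next are his [n] and L_n.\<close>

definition carlitz_poly :: "nat \<Rightarrow> 'a::{finite,field} fls \<Rightarrow> 'a fls" where
  "carlitz_poly N z = (\<Prod>c\<in>polys_below N. (z - iota c))"

definition carlitz_bracket :: "nat \<Rightarrow> 'a::{finite,field} fls" where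
  "carlitz_bracket n = kT ^ (CARD('a) ^ n) - kT"

definition carlitz_L :: "nat \<Rightarrow> 'a::{finite,field} fls" where
  "carlitz_L n = (\<Prod>j<n. carlitz_bracket (Suc j))"

lemma carlitz_bracket_nonzero [simp]: "carlitz_bracket (Suc n) \<noteq> (0 :: 'a::{finite,field} fls)"
proof
  assume "carlitz_bracket (Suc n) = (0 :: 'a fls)"
  then have "fls_subdegree (kT ^ (CARD('a) ^ Suc n) :: 'a fls) = fls_subdegree (kT :: 'a fls)"
    by (simp add: carlitz_bracket_def)
  then have "int (CARD('a) ^ Suc n) * (1 - int CARD('a)) = 1 * (1 - int CARD('a))"
    by simp
  then have "CARD('a) ^ Suc n = 1"
    using card_gt_1[where 'a = 'a] unfolding mult_cancel_right by (auto simp del: of_nat_power power_Suc)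
  then show False using card_gt_1[where 'a = 'a] by simp
qed

lemma carlitz_L_nonzero [simp]: "carlitz_L n \<noteq> 0"
  by (simp add: carlitz_L_def)

lemma carlitz_L_Suc: "carlitz_L (Suc n) = carlitz_L n * carlitz_bracket (Suc n)"
  by (simp add: carlitz_L_def)

lemma iota_D:
  "iota (D n) = (\<Prod>i<n. kT ^ (CARD('a) ^ n) - kT ^ (CARD('a) ^ i) :: 'a::{finite,field} fls)"
  by (simp add: D_def)

lemma iota_D_0 [simp]: "iota (D 0) = 1"
  by (simp add: iota_D)

text \<open>Frobenius is additive, so every factor except the one with \<open>i = 0\<close> is the
  q-th power of a factor of D_n.\<close>

lemma iota_D_Suc:
  "iota (D (Suc n)) = carlitz_bracket (Suc n) * iota (D n :: 'a::{finite,field} poly) ^ CARD('a)"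
proof -
  have "(\<Prod>i<n. kT ^ (CARD('a) ^ Suc n) - kT ^ (CARD('a) ^ Suc i)) =
        (\<Prod>i<n. kT ^ (CARD('a) ^ n) - kT ^ (CARD('a) ^ i) :: 'a fls) ^ CARD('a)"
    unfolding prod_power_distrib
    by (simp only: frob_diff power_Suc2 power_mult)
  then show ?thesis
    unfolding iota_D prod.lessThan_Suc_shift by (simp add: carlitz_bracket_def)
qed

lemma iota_D_nonzero [simp]: "iota (D n) \<noteq> 0"
  by (induction n) (simp_all add: iota_D_Suc del: iota_eq_0_iff)

lemma carlitz_bracket_subdegree:
  "fls_subdegree (carlitz_bracket (Suc n) :: 'a::{finite,field} fls) = int (CARD('a) ^ Suc n) * (1 - int CARD('a))"
proof -
  have "int (CARD('a) ^ Suc n) * (1 - int CARD('a)) < 1 - int CARD('a)"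
    using card_gt_1[where 'a = 'a] one_less_power[of "CARD('a)" "Suc n"] by (simp del: power_Suc)
  then show ?thesis
    unfolding carlitz_bracket_def by (subst fls_subdegree_diff_eq1) auto
qed

lemma iota_D_subdegree:
  "fls_subdegree (iota (D n :: 'a::{finite,field} poly)) = int n * int (CARD('a) ^ n) * (1 - int CARD('a))"
proof (induction n)
  case (Suc n)
  have "fls_subdegree (iota (D (Suc n) :: 'a poly)) =
      fls_subdegree (carlitz_bracket (Suc n) :: 'a fls) + int CARD('a) * fls_subdegree (iota (D n :: 'a poly))"
    by (simp add: iota_D_Suc fls_subdegree_pow del: iota_eq_0_iff)
  then show ?case
    unfolding Suc.IH carlitz_bracket_subdegree by (simp add: algebra_simps)
qed simp

lemma carlitz_poly_0 [simp]: "carlitz_poly 0 z = z"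
  by (simp add: carlitz_poly_def)

lemma carlitz_poly_iota:
  assumes "p \<in> polys_below N" shows "carlitz_poly N (iota p) = 0"
  using assms by (auto simp: carlitz_poly_def intro!: bexI[of _ p])

lemma carlitz_poly_add_iota:
  assumes "p \<in> polys_below N" shows "carlitz_poly N (z + iota p) = carlitz_poly N z"
  unfolding carlitz_poly_def
  by (rule prod.reindex_bij_witness[of _ "\<lambda>c. c + p" "\<lambda>c. c - p"])
     (use assms in \<open>auto intro: polys_below_add polys_below_diff\<close>)

lemma prod_polys_below_Suc:
  "(\<Prod>c\<in>polys_below (Suc N). g c) = (\<Prod>\<epsilon>\<in>UNIV. \<Prod>c\<in>polys_below N. g (monom \<epsilon> N + c))"
  for g :: "'a::{finite,field} poly \<Rightarrow> 'b::comm_monoid_mult"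
  unfolding polys_below_Suc
  by (subst prod.reindex[OF inj_on_polys_below_Suc]) (simp add: prod.cartesian_product case_prod_unfold)

text \<open>The three claims depend on each other: linearity at N lets
  \<open>prod_diff_const_mult\<close> evaluate the product over the coefficient of T^N, and the
  resulting combination of additive powers is again linear, at \<open>Suc N\<close>.\<close>

lemma carlitz_poly_linear_Suc:
  fixes z :: "'a::{finite,field} fls"
  shows "(\<forall>z y. carlitz_poly N (z + y) = carlitz_poly N z + carlitz_poly N (y :: 'a fls)) \<and>
         (\<forall>c z. carlitz_poly N (fls_const c * z) = fls_const c * carlitz_poly N (z :: 'a fls)) \<and>
         (\<forall>z. carlitz_poly (Suc N) z = carlitz_poly N (z :: 'a fls) ^ CARD('a) -
                carlitz_poly N (kT ^ N) ^ (CARD('a) - 1) * carlitz_poly N z)"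
proof (induction N)
  have step: "carlitz_poly (Suc N) z = carlitz_poly N z ^ CARD('a) -
                carlitz_poly N (kT ^ N) ^ (CARD('a) - 1) * carlitz_poly N z"
    if add: "\<forall>z y. carlitz_poly N (z + y) = carlitz_poly N z + carlitz_poly N (y :: 'a fls)"
      and const: "\<forall>c z. carlitz_poly N (fls_const c * z) = fls_const c * carlitz_poly N (z :: 'a fls)"
    for N and z :: "'a fls"
  proof -
    have diff: "carlitz_poly N (z - fls_const c * y) = carlitz_poly N z - fls_const c * carlitz_poly N y" for c and z y :: "'a fls"
      using add[rule_format, of z "fls_const (- c) * y"] const[rule_format, of "- c" y] by simp
    have "carlitz_poly (Suc N) z = (\<Prod>\<epsilon>\<in>UNIV. carlitz_poly N (z - fls_const \<epsilon> * kT ^ N))"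
      by (simp add: carlitz_poly_def prod_polys_below_Suc diff_diff_eq)
    then show ?thesis by (simp add: diff prod_diff_const_mult)
  qed
  case 0
  show ?case by (intro conjI allI step) simp_all
  case (Suc N)
  then have rec: "carlitz_poly (Suc N) z = carlitz_poly N z ^ CARD('a) -
                carlitz_poly N (kT ^ N) ^ (CARD('a) - 1) * carlitz_poly N z" for z :: "'a fls"
    by blast
  from Suc have *: "carlitz_poly N (z + y) = carlitz_poly N z + carlitz_poly N y"
    "carlitz_poly N (fls_const c * z) = fls_const c * carlitz_poly N z" for z y :: "'a fls" and c
    by blast+
  have add: "carlitz_poly (Suc N) (z + y) = carlitz_poly (Suc N) z + carlitz_poly (Suc N) y"
    for z y :: "'a fls"
    unfolding rec * frob_add by (simp add: algebra_simps)
  have const: "carlitz_poly (Suc N) (fls_const c * z) = fls_const c * carlitz_poly (Suc N) z"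
    for c and z :: "'a fls"
    unfolding rec * power_mult_distrib frob_const by (simp add: algebra_simps)
  show ?case by (intro conjI allI step add const)
qed

lemmas carlitz_poly_const_mult = carlitz_poly_linear_Suc[THEN conjunct2, THEN conjunct1, rule_format]
lemmas carlitz_poly_Suc = carlitz_poly_linear_Suc[THEN conjunct2, THEN conjunct2, rule_format]

text \<open>The finite form of the functional equation of the Carlitz exponential. At
  \<open>z = kT ^ N\<close>, a root of e_(N+1), it evaluates e_(N+1)(T^(N+1)); the induction step
  itself needs this value.\<close>

lemma carlitz_poly_kT:
  fixes z :: "'a::{finite,field} fls"
  shows "carlitz_poly (Suc N) (kT * z) =
           kT * carlitz_poly (Suc N) z + carlitz_bracket (Suc N) * carlitz_poly N z ^ CARD('a)"
proof (induction N arbitrary: z)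
  case 0
  show ?case by (simp add: carlitz_poly_Suc carlitz_bracket_def algebra_simps)
next
  case (Suc N)
  let ?q = "CARD('a)"
  define B where "B = (carlitz_bracket (Suc N) :: 'a fls)"
  define M where "M = carlitz_poly N (kT ^ N :: 'a fls)"
  define M1 where "M1 = carlitz_poly (Suc N) (kT ^ Suc N :: 'a fls)"
  define E where "E = carlitz_poly (Suc N) z"
  define F where "F = carlitz_poly N z ^ ?q"
  define K where "K = M ^ (?q * (?q - 1))"
  have q: "Suc (?q - 1) = ?q" using card_gt_1[where 'a = 'a] by simp
  have "carlitz_poly (Suc N) (kT ^ N :: 'a fls) = 0"
    using carlitz_poly_iota[of "monom 1 N" "Suc N"] by (simp add: polys_below_iff)
  then have "M1 = B * M ^ ?q"
    using Suc.IH[of "kT ^ N"] by (simp add: M1_def M_def B_def)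
  \<comment> \<open>The same \<open>K\<close> occurs in \<open>E ^ q\<close>, so the terms in
    \<open>F\<close> combine to \<open>B ^ q * E ^ q\<close>.\<close>
  then have M1: "B * M1 ^ (?q - 1) = B ^ ?q * K"
    by (metis K_def mult.assoc power_Suc power_mult power_mult_distrib q)
  have Eq: "E ^ ?q = F ^ ?q - K * F"
    unfolding E_def carlitz_poly_Suc K_def F_def M_def[symmetric]
    by (simp add: frob_diff power_mult_distrib mult.commute flip: power_mult)
  have Bq: "B ^ ?q = kT ^ (?q ^ Suc (Suc N)) - kT ^ ?q"
    by (simp add: B_def carlitz_bracket_def frob_diff mult.commute flip: power_mult)
  have "carlitz_poly (Suc (Suc N)) (kT * z) = (kT * E + B * F) ^ ?q - M1 ^ (?q - 1) * (kT * E + B * F)"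
    unfolding carlitz_poly_Suc[of "Suc N"] Suc.IH by (simp add: E_def F_def B_def M1_def)
  also have "\<dots> = kT ^ ?q * E ^ ?q + B ^ ?q * F ^ ?q - M1 ^ (?q - 1) * kT * E - (B * M1 ^ (?q - 1)) * F"
    by (simp add: frob_add power_mult_distrib algebra_simps)
  also have "\<dots> = kT ^ ?q * E ^ ?q + B ^ ?q * E ^ ?q - M1 ^ (?q - 1) * kT * E"
    unfolding M1 Eq by (simp add: algebra_simps)
  also have "\<dots> = kT * (E ^ ?q - M1 ^ (?q - 1) * E) + carlitz_bracket (Suc (Suc N)) * E ^ ?q"
    unfolding Bq carlitz_bracket_def by (simp add: algebra_simps)
  also have "E ^ ?q - M1 ^ (?q - 1) * E = carlitz_poly (Suc (Suc N)) z"
    unfolding carlitz_poly_Suc[of "Suc N" z] by (simp add: E_def M1_def)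
  finally show ?case by (simp add: E_def)
qed

lemma carlitz_poly_kT_power: "carlitz_poly N (kT ^ N) = iota (D N :: 'a::{finite,field} poly)"
proof (induction N)
  case (Suc N)
  have "carlitz_poly (Suc N) (kT ^ N :: 'a fls) = 0"
    using carlitz_poly_iota[of "monom 1 N" "Suc N"] by (simp add: polys_below_iff)
  with Suc show ?case using carlitz_poly_kT[of N "kT ^ N :: 'a fls"] by (simp add: iota_D_Suc)
qed simp

text \<open>The involution taking c to T^N - c exchanges the monic polynomials of degree N with
  those of degree below N, so the product is e_N(T^N).\<close>

lemma prod_monic: "(\<Prod>c\<in>{c. lead_coeff c = 1 \<and> degree c = N}. iota c) = iota (D N :: 'a::{finite,field} poly)"
proof -
  have "(\<Prod>c\<in>{c :: 'a poly. lead_coeff c = 1 \<and> degree c = N}. iota c) = carlitz_poly N (kT ^ N)"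
    unfolding carlitz_poly_def
  proof (rule prod.reindex_bij_witness[of _ "\<lambda>c. monom 1 N - c" "\<lambda>c. monom 1 N - c"])
    fix c :: "'a poly" assume c: "c \<in> {c. lead_coeff c = 1 \<and> degree c = N}"
    show "monom 1 N - c \<in> polys_below N"
      using c by (auto simp: polys_below_iff le_less coeff_eq_0)
  next
    fix c :: "'a poly" assume c: "c \<in> polys_below N"
    then have coeff: "coeff (monom 1 N - c) i = (if i = N then 1 else 0)" if "i \<ge> N" for i
      using that by (simp add: polys_below_iff)
    have "degree (monom 1 N - c) = N"
    proof (rule antisym)
      show "degree (monom 1 N - c) \<le> N" by (rule degree_le) (auto simp: coeff simp del: coeff_diff)
      show "N \<le> degree (monom 1 N - c)" by (rule le_degree) (simp add: coeff del: coeff_diff)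
    qed
    then show "monom 1 N - c \<in> {c. lead_coeff c = 1 \<and> degree c = N}"
      using coeff[of N] by simp
  qed auto
  then show ?thesis by (simp add: carlitz_poly_kT_power)
qed

lemma Psi_carlitz_poly: "Psi N z = carlitz_poly N z / iota (D N)"
  by (simp add: Psi_def prod_monic carlitz_poly_def polys_below_def del: iota_prod)

lemma Psi_0 [simp]: "Psi 0 z = z"
  by (simp add: Psi_carlitz_poly)

lemma Psi_zero [simp]: "Psi N 0 = (0 :: 'a::{finite,field} fls)"
  using carlitz_poly_iota[of "0 :: 'a poly" N] by (simp add: Psi_carlitz_poly)

text \<open>The index \<open>Suc N\<close> matters: constants are roots of
  \<open>Psi (Suc N)\<close>, but \<open>Psi 0\<close> is the identity.\<close>

lemma Psi_diff_const: "Psi (Suc N) (z - fls_const c) = Psi (Suc N) z"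
  using carlitz_poly_add_iota[of "[:- c:]" "Suc N" z]
  by (simp add: Psi_carlitz_poly iota_const polys_below_iff coeff_pCons split: nat.splits)

lemma Psi_kT: "Psi (Suc N) (kT * z) = kT * Psi (Suc N) z + Psi N z ^ CARD('a)"
  for z :: "'a::{finite,field} fls"
  by (simp add: Psi_carlitz_poly carlitz_poly_kT iota_D_Suc power_divide add_divide_distrib del: iota_eq_0_iff)

lemma Psi_Suc: "Psi (Suc N) z = (Psi N z ^ CARD('a) - Psi N z) / carlitz_bracket (Suc N)"
  for z :: "'a::{finite,field} fls"
proof -
  have "iota (D N :: 'a poly) ^ CARD('a) = iota (D N) ^ (CARD('a) - 1) * iota (D N)"
    using card_gt_1[where 'a = 'a] by (simp flip: power_Suc2)
  then show ?thesis
    by (simp add: Psi_carlitz_poly carlitz_poly_Suc carlitz_poly_kT_power iota_D_Suc power_divide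
        field_simps del: iota_eq_0_iff)
qed

section \<open>Explicit coefficients of Psi_N and of the finite lattice products\<close>

definition Psi_coeff :: "nat \<Rightarrow> nat \<Rightarrow> 'a::{finite,field} fls" where
  "Psi_coeff N i = (- 1) ^ (N - i) / (iota (D i) * carlitz_L (N - i) ^ (CARD('a) ^ i))"

text \<open>Comparison of coefficients in \<open>Psi_Suc\<close>. It rests on [N+1] = [j+1] +
  [l+1]^(q^(j+1)) for N + 1 = (j + 1) + (l + 1), which splits the left side into the two terms on
  the right.\<close>

lemma Psi_coeff_Suc:
  fixes N i :: nat
  assumes "i \<le> Suc N"
  shows "carlitz_bracket (Suc N) * (Psi_coeff (Suc N) i :: 'a::{finite,field} fls) =
           (case i of 0 \<Rightarrow> 0 | Suc j \<Rightarrow> Psi_coeff N j ^ CARD('a)) - (if i \<le> N then Psi_coeff N i else 0)"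
proof -
  consider "i = 0" | "i = Suc N" | j l where "i = Suc j" "N = Suc j + l"
    using assms by (metis le_Suc_ex le_SucE not0_implies_Suc)
  then show ?thesis
  proof cases
    case 1
    then show ?thesis by (simp add: Psi_coeff_def carlitz_L_Suc)
  next
    case 2
    then show ?thesis
      by (simp add: Psi_coeff_def carlitz_L_def iota_D_Suc power_divide del: iota_eq_0_iff)
  next
    case 3
    let ?q = "CARD('a)"
    define b where "b = (carlitz_bracket (Suc j) :: 'a fls)"
    define c where "c = (carlitz_bracket (Suc l) :: 'a fls) ^ (?q ^ Suc j)"
    define d where "d = iota (D j :: 'a poly) ^ ?q"
    define L where "L = (carlitz_L l :: 'a fls) ^ (?q ^ Suc j)"
    define s where "s = ((- 1) ^ l :: 'a fls)"
    have nz: "b \<noteq> 0" "c \<noteq> 0" "d \<noteq> 0" "L \<noteq> 0"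
      by (simp_all add: b_def c_def d_def L_def del: iota_eq_0_iff)
    have "?q ^ Suc N = ?q ^ Suc l * ?q ^ Suc j" by (simp add: 3 power_add)
    then have br: "carlitz_bracket (Suc N) = b + c"
      by (simp add: b_def c_def carlitz_bracket_def frob_diff_pow del: power_Suc flip: power_mult)
    have 1: "Psi_coeff (Suc N) i = - s / (b * d * (L * c))"
      by (simp add: Psi_coeff_def 3 b_def c_def d_def L_def s_def carlitz_L_Suc iota_D_Suc power_mult_distrib
            del: iota_eq_0_iff)
    have 2: "Psi_coeff N i = s / (b * d * L)"
      by (simp add: Psi_coeff_def 3 b_def d_def L_def s_def iota_D_Suc)
    have 4: "Psi_coeff N j ^ ?q = - s / (d * (L * c))"
      using frob_neg_one_power[of "Suc l", where 'a = 'a]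
      by (simp add: Psi_coeff_def 3 c_def d_def L_def s_def carlitz_L_Suc power_mult_distrib power_divide
            frob_minus mult_ac flip: power_mult)
    have "(b + c) * (- s / (b * d * (L * c))) = - s / (d * (L * c)) - s / (b * d * L)"
      using nz by (simp add: field_simps)
    moreover have "(case i of 0 \<Rightarrow> 0 | Suc j \<Rightarrow> Psi_coeff N j ^ ?q) = - s / (d * (L * c))"
      and "(if i \<le> N then Psi_coeff N i else 0) = s / (b * d * L)"
      using 2 4 by (simp_all add: 3)
    ultimately show ?thesis unfolding br 1 by (simp only:)
  qed
qed

lemma Psi_expand: "Psi N z = (\<Sum>i\<le>N. Psi_coeff N i * z ^ (CARD('a) ^ i))"
  for z :: "'a::{finite,field} fls"
proof (induction N)
  case 0
  show ?case by (simp add: Psi_coeff_def carlitz_L_def)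
next
  case (Suc N)
  let ?q = "CARD('a)"
  let ?P = "\<lambda>i. (case i of 0 \<Rightarrow> 0 | Suc j \<Rightarrow> Psi_coeff N j ^ ?q)"
  let ?R = "\<lambda>i. (if i \<le> N then Psi_coeff N i else 0)"
  have "carlitz_bracket (Suc N) * (\<Sum>i\<le>Suc N. Psi_coeff (Suc N) i * z ^ (?q ^ i)) =
        (\<Sum>i\<le>Suc N. (?P i - ?R i) * z ^ (?q ^ i))"
    unfolding sum_distrib_left by (intro sum.cong) (simp_all only: Psi_coeff_Suc atMost_iff mult.assoc[symmetric])
  also have "\<dots> = (\<Sum>i\<le>Suc N. ?P i * z ^ (?q ^ i)) - (\<Sum>i\<le>Suc N. ?R i * z ^ (?q ^ i))"
    by (simp only: left_diff_distrib sum_subtractf)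
  also have "(\<Sum>i\<le>Suc N. ?P i * z ^ (?q ^ i)) = (\<Sum>i\<le>N. Psi_coeff N i * z ^ (?q ^ i)) ^ ?q"
    unfolding sum.atMost_Suc_shift
    by (simp add: frob_sum power_mult_distrib mult.commute[of ?q] power_mult)
  also have "(\<Sum>i\<le>Suc N. ?R i * z ^ (?q ^ i)) = (\<Sum>i\<le>N. Psi_coeff N i * z ^ (?q ^ i))"
    by simp
  finally show ?case
    unfolding Psi_Suc Suc.IH by (simp add: field_simps del: sum.atMost_Suc)
qed

text \<open>This is the linear coefficient of e_N. In the step, polynomials are sorted by their
  coefficient \<epsilon> of T^N: \<epsilon> = 0 is the induction hypothesis, every other \<epsilon>
  contributes e_N(- \<epsilon> T^N) = - \<epsilon> D_N, and Wilson's theorem evaluates the product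
  of the constants.\<close>

lemma prod_minus_iota:
  "(\<Prod>a\<in>polys_below N - {0}. - iota a) = iota (D N) * (- 1) ^ N / (carlitz_L N :: 'a::{finite,field} fls)"
proof (induction N)
  case 0
  show ?case by (simp add: carlitz_L_def)
next
  case (Suc N)
  let ?q = "CARD('a)" and ?V = "polys_below N :: 'a poly set"
  let ?h = "\<lambda>(\<epsilon>, c). monom \<epsilon> N + c :: 'a poly"
  have q: "Suc (?q - 1) = ?q" using card_gt_1[where 'a = 'a] by simp
  have "polys_below (Suc N) - {0} = ?h ` (UNIV \<times> ?V) - ?h ` {(0, 0)}"
    by (simp add: polys_below_Suc)
  also have "\<dots> = ?h ` (UNIV \<times> ?V - {(0, 0)})"
    by (rule inj_on_image_set_diff[OF inj_on_polys_below_Suc, symmetric]) auto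
  also have "UNIV \<times> ?V - {(0, 0)} = {0} \<times> (?V - {0}) \<union> (UNIV - {0}) \<times> ?V"
    by auto
  finally have set: "polys_below (Suc N) - {0} = ?h ` ({0} \<times> (?V - {0}) \<union> (UNIV - {0}) \<times> ?V)" .
  have "(\<Prod>a\<in>polys_below (Suc N) - {0}. - iota a) =
        (\<Prod>x\<in>{0} \<times> (?V - {0}) \<union> (UNIV - {0}) \<times> ?V. - iota (?h x))"
    unfolding set
    by (subst prod.reindex) (auto intro: inj_on_subset[OF inj_on_polys_below_Suc])
  also have "\<dots> = (\<Prod>x\<in>{0} \<times> (?V - {0}). - iota (?h x)) * (\<Prod>x\<in>(UNIV - {0}) \<times> ?V. - iota (?h x))"
    by (rule prod.union_disjoint) auto
  also have "(\<Prod>x\<in>{0} \<times> (?V - {0}). - iota (?h x)) = (\<Prod>a\<in>?V - {0}. - iota a)"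
    by (rule prod.reindex_bij_witness[of _ "\<lambda>c. (0, c)" snd]) auto
  also have "(\<Prod>x\<in>(UNIV - {0}) \<times> ?V. - iota (?h x)) =
             (\<Prod>\<epsilon>\<in>UNIV - {0}. carlitz_poly N (fls_const (- \<epsilon>) * kT ^ N))"
    by (simp add: carlitz_poly_def prod.cartesian_product case_prod_unfold)
  also have "\<dots> = (\<Prod>\<epsilon>\<in>UNIV - {0}. - fls_const \<epsilon> * iota (D N))"
    unfolding carlitz_poly_const_mult carlitz_poly_kT_power by simp
  also have "\<dots> = - (iota (D N) ^ (?q - 1))"
    using prod_minus_nonzero_const[where 'a = 'a] unfolding prod.distrib by (simp add: card_Diff_singleton)
  also have "(\<Prod>a\<in>?V - {0}. - iota a) * - (iota (D N) ^ (?q - 1)) =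
             (iota (D N) * iota (D N) ^ (?q - 1)) * (- 1) ^ Suc N / (carlitz_L N :: 'a fls)"
    unfolding Suc.IH by simp
  also have "iota (D N) * iota (D N) ^ (?q - 1) = (iota (D N) ^ ?q :: 'a fls)"
    using q by (simp flip: power_Suc)
  also have "iota (D N) ^ ?q * (- 1) ^ Suc N / (carlitz_L N :: 'a fls) = iota (D (Suc N)) * (- 1) ^ Suc N / (carlitz_L (Suc N) :: 'a fls)"
    by (simp add: q iota_D_Suc carlitz_L_Suc del: power_Suc)
  finally show ?case .
qed

text \<open>Up to normalisation by its linear coefficient the product is e_N(z / w), so the
  expansion of \<open>Psi N\<close> applies.\<close>

lemma lattice_product_expand:
  fixes z w :: "'a::{finite,field} fls"
  assumes "w \<noteq> 0"
  shows "z * (\<Prod>a\<in>polys_below N - {0}. (1 - z / (w * iota a))) =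
         (\<Sum>i\<le>N. w * (z / w) ^ (CARD('a) ^ i) *
            ((- 1) ^ i * carlitz_L N / (iota (D i) * carlitz_L (N - i) ^ (CARD('a) ^ i))))"
proof -
  let ?W = "polys_below N - {0 :: 'a poly}"
  have "(\<Prod>a\<in>?W. (1 - z / (w * iota a))) = (\<Prod>a\<in>?W. (z / w - iota a) / - iota a)"
    using assms by (intro prod.cong) (auto simp: field_simps)
  also have "\<dots> = (\<Prod>a\<in>?W. z / w - iota a) / (\<Prod>a\<in>?W. - iota a)"
    by (rule prod_dividef)
  finally have "z * (\<Prod>a\<in>?W. (1 - z / (w * iota a))) =
      w * ((z / w) * (\<Prod>a\<in>?W. z / w - iota a)) / (\<Prod>a\<in>?W. - iota a)"
    using assms by simp
  also have "(z / w) * (\<Prod>a\<in>?W. z / w - iota a) = carlitz_poly N (z / w)"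
    unfolding carlitz_poly_def by (subst prod.remove[of _ 0]) auto
  also have "w * carlitz_poly N (z / w) / (\<Prod>a\<in>?W. - iota a) = w * ((- 1) ^ N * carlitz_L N) * Psi N (z / w)"
    unfolding prod_minus_iota Psi_carlitz_poly
    by (cases "even N") (simp_all add: field_simps del: iota_eq_0_iff)
  also have "\<dots> = (\<Sum>i\<le>N. w * (z / w) ^ (CARD('a) ^ i) *
            ((- 1) ^ i * carlitz_L N / (iota (D i) * carlitz_L (N - i) ^ (CARD('a) ^ i))))"
    unfolding Psi_expand sum_distrib_left
  proof (rule sum.cong)
    fix i assume "i \<in> {..N}"
    then obtain l where l: "N = i + l" by (metis atMost_iff le_Suc_ex)
    have "(- 1) ^ l * (- 1) ^ l = (1 :: 'a fls)" by (simp flip: power_mult_distrib)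
    then have "(- 1) ^ N * (- 1) ^ (N - i) = ((- 1) ^ i :: 'a fls)"
      by (simp add: l power_add mult.assoc)
    then show "w * ((- 1) ^ N * carlitz_L N) * (Psi_coeff N i * (z / w) ^ CARD('a) ^ i) =
        w * (z / w) ^ (CARD('a) ^ i) *
            ((- 1) ^ i * carlitz_L N / (iota (D i) * carlitz_L (N - i) ^ (CARD('a) ^ i)))"
      by (simp add: Psi_coeff_def mult_ac flip: \<open>(- 1) ^ N * (- 1) ^ (N - i) = ((- 1) ^ i :: 'a fls)\<close>)
  qed simp
  finally show ?thesis .
qed

section \<open>The Carlitz exponential\<close>

lemma ord_ge_expC_term:
  fixes z :: "'a::{finite,field} fls"
  assumes "ord_ge m z"
  shows "ord_ge (int (CARD('a) ^ n) * (m + int n * (int CARD('a) - 1))) (z ^ (CARD('a) ^ n) / iota (D n))"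
proof -
  have "ord_ge (int (CARD('a) ^ n) * (int n * (int CARD('a) - 1))) (inverse (iota (D n :: 'a poly)))"
    by (rule ord_ge_inverse) (simp add: iota_D_subdegree algebra_simps)
  then show ?thesis
    unfolding divide_inverse
    by (rule ord_ge_mult[OF ord_ge_power[OF assms order_refl]]) (simp add: algebra_simps)
qed

lemma expC_term_eventually:
  fixes z :: "'a::{finite,field} fls"
  shows "eventually (\<lambda>n. ord_ge k (z ^ (CARD('a) ^ n) / iota (D n))) sequentially"
  \<comment> \<open>The threshold makes \<open>?m + n (q - 1)\<close> at least
    \<open>max 0 k\<close>; being nonnegative, the bound survives the factor q^n.\<close>
  using eventually_ge_at_top[of "nat (max 0 k - min 0 (fls_subdegree z))"]
proof eventually_elim
  case (elim n)
  let ?m = "min 0 (fls_subdegree z)"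
  have m: "ord_ge ?m z" by (auto simp: ord_ge_iff_subdegree)
  have "int n \<ge> max 0 k - ?m" using elim by simp
  moreover have "int n * 1 \<le> int n * (int CARD('a) - 1)"
    using card_gt_1[where 'a = 'a] by (intro mult_left_mono) auto
  ultimately have *: "max 0 k \<le> ?m + int n * (int CARD('a) - 1)" by linarith
  also have "1 * \<dots> \<le> int (CARD('a) ^ n) * \<dots>"
    using * by (intro mult_right_mono) (auto simp: int_one_le_iff_zero_less)
  finally show ?case by (intro ord_ge_mono[OF ord_ge_expC_term[OF m]]) simp
qed

lemma expC_sums: "(\<lambda>n. z ^ (CARD('a) ^ n) / iota (D n)) sums expC z" for z :: "'a::{finite,field} fls"
  unfolding expC_def by (intro summable_sums summable_fls expC_term_eventually)

lemma expC_add: "expC (z + y) = expC z + expC y"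
proof -
  have "(\<lambda>n. z ^ (CARD('a) ^ n) / iota (D n) + y ^ (CARD('a) ^ n) / iota (D n)) sums (expC z + expC y)"
    by (intro sums_add expC_sums)
  then show ?thesis
    using expC_sums[of "z + y"] by (simp add: frob_add_pow add_divide_distrib sums_unique2)
qed

lemma expC_const_mult: "expC (fls_const c * z) = fls_const c * expC z"
  using sums_fls_mult[OF expC_sums[of z], of "fls_const c"] expC_sums[of "fls_const c * z"]
  by (simp add: power_mult_distrib frob_const_pow sums_unique2)

lemma expC_diff: "expC (z - y) = expC z - expC y"
  using expC_add[of "z - y" y] by simp

text \<open>As D_(n+1) = [n+1] D_n^q, the q-th power of the n-th term is the term of index n + 1 in
  the series of exp_C(T z) - T exp_C(z), whose term at index 0 vanishes.\<close>

lemma expC_kT: "expC (kT * z) = kT * expC z + expC z ^ CARD('a)" for z :: "'a::{finite,field} fls"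
proof -
  let ?q = "CARD('a)"
  let ?t = "\<lambda>n. z ^ (?q ^ n) / iota (D n)"
  have "(\<lambda>n. ?t n ^ ?q) sums (expC z ^ ?q)"
    using sums_frob[OF expC_sums, of z 1] by simp
  moreover have "?t n ^ ?q = ((kT * z) ^ (?q ^ Suc n) / iota (D (Suc n)) - kT * ?t (Suc n))" for n
  proof -
    have "(kT * z) ^ (?q ^ Suc n) = (kT + carlitz_bracket (Suc n)) * z ^ (?q ^ Suc n)"
      by (simp add: carlitz_bracket_def power_mult_distrib)
    moreover have "z ^ (?q ^ Suc n) = (z ^ (?q ^ n)) ^ ?q" by (simp add: mult.commute flip: power_mult)
    ultimately show ?thesis
      by (simp add: iota_D_Suc power_divide field_simps del: power_Suc iota_eq_0_iff)
  qed
  ultimately have "(\<lambda>n. (kT * z) ^ (?q ^ Suc n) / iota (D (Suc n)) - kT * ?t (Suc n)) sums (expC z ^ ?q)"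
    by simp
  from sums_Suc[OF this]
  have "(\<lambda>n. (kT * z) ^ (?q ^ n) / iota (D n) - kT * ?t n) sums (expC z ^ ?q)"
    by simp
  moreover have "(\<lambda>n. (kT * z) ^ (?q ^ n) / iota (D n) - kT * ?t n) sums (expC (kT * z) - kT * expC z)"
    by (intro sums_fls_diff sums_fls_mult expC_sums)
  ultimately show ?thesis using sums_unique2 by (fastforce simp: algebra_simps)
qed

text \<open>The order 1 - q is the least one at which the linear term dominates: at order -q, that
  of the period, the term n = 1 has the same size.\<close>

lemma ord_ge_expC_diff:
  fixes z :: "'a::{finite,field} fls"
  assumes z: "ord_ge m z" and m: "m \<ge> 1 - int CARD('a)"
  shows "ord_ge (m + 1) (expC z - z)"
proof -
  let ?q = "CARD('a)"
  let ?t = "\<lambda>n. z ^ (?q ^ n) / iota (D n)"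
  have "(\<lambda>n. ?t n - (if n = 0 then z else 0)) sums (expC z - z)"
    by (intro sums_fls_diff expC_sums sums_single)
  then show ?thesis
  proof (rule ord_ge_sums)
    fix n
    show "ord_ge (m + 1) (?t n - (if n = 0 then z else 0))"
    proof (cases n)
      case (Suc k)
      define Q where "Q = int (?q ^ n)"
      have Q: "Q \<ge> 1" by (simp add: Q_def int_one_le_iff_zero_less)
      have "(Q - 1) * (1 - int ?q) \<le> (Q - 1) * m"
        by (intro mult_left_mono) (use m Q in auto)
      moreover have "0 \<le> Q * (int k * (int ?q - 1))"
        using Q card_gt_1[where 'a = 'a] by simp
      ultimately have "m + (int ?q - 1) \<le> Q * (m + int n * (int ?q - 1))"
        by (simp add: Suc algebra_simps)
      then have "m + 1 \<le> Q * (m + int n * (int ?q - 1))"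
        using card_gt_1[where 'a = 'a] by simp
      then have "ord_ge (m + 1) (?t n)"
        by (intro ord_ge_mono[OF ord_ge_expC_term[OF z]]) (simp add: Q_def)
      then show ?thesis by (simp add: Suc)
    qed simp
  qed
qed

locale carlitz =
  fixes Ttil :: "'a::{finite,field} fls"
  assumes Ttil: "Ttil ^ (CARD('a) - 1) = - kT"
begin

lemma Ttil_nonzero [simp]: "Ttil \<noteq> 0"
  using Ttil card_gt_1[where 'a = 'a] by (auto simp: zero_power)

lemma Ttil_frob: "Ttil ^ CARD('a) = - kT * Ttil"
proof -
  have "Ttil ^ Suc (CARD('a) - 1) = - kT * Ttil" by (simp only: power_Suc2 Ttil)
  then show ?thesis using card_gt_1[where 'a = 'a] by simp
qed

lemma subdegree_Ttil [simp]: "fls_subdegree Ttil = - 1"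
proof -
  have "fls_subdegree (Ttil ^ (CARD('a) - 1)) = - (int CARD('a) - 1)"
    unfolding Ttil by simp
  then have "(int CARD('a) - 1) * fls_subdegree Ttil = (int CARD('a) - 1) * - 1"
    using card_gt_1[where 'a = 'a] by (simp add: fls_subdegree_pow of_nat_diff algebra_simps)
  then show ?thesis using card_gt_1[where 'a = 'a] by (simp only: mult_cancel_left) simp
qed

text \<open>\<open>Ttil * fls_X\<close> is a root of unity of exponent q - 1, hence fixed by
  Frobenius: \<open>Ttil\<close> equals 1/X only up to a factor in F_q.\<close>

lemma Ttil_X_power: "Ttil ^ (CARD('a) ^ n) * fls_X ^ (CARD('a) ^ n - 1) = Ttil"
proof -
  let ?q = "CARD('a)"
  have "kT * (- (fls_X ^ (?q - 1))) = (1 :: 'a fls)"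
    using inverse_kT_frob[of 0, where 'a = 'a] right_inverse[of "kT :: 'a fls"] by simp
  then have q: "(Ttil * fls_X) ^ (?q - 1) = 1"
    using Ttil by (simp add: power_mult_distrib)
  have "(Ttil * fls_X) ^ Suc (?q - 1) = Ttil * fls_X"
    by (simp only: power_Suc q mult_1_right)
  then have "(Ttil * fls_X) ^ ?q = Ttil * fls_X" using card_gt_1[where 'a = 'a] by simp
  then have "(Ttil * fls_X) ^ (?q ^ n) = Ttil * fls_X"
    by (induction n) (simp_all add: power_mult)
  moreover have "fls_X ^ (?q ^ n) = fls_X ^ (?q ^ n - 1) * (fls_X :: 'a fls)"
    by (simp flip: power_Suc2)
  ultimately have "(Ttil ^ (?q ^ n) * fls_X ^ (?q ^ n - 1)) * fls_X = Ttil * fls_X"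
    by (simp add: power_mult_distrib mult.assoc)
  then show ?thesis by (simp only: mult_cancel_right) simp
qed

section \<open>Existence and uniqueness of the Carlitz period\<close>

definition exponent_sum :: "nat \<Rightarrow> nat" where
  "exponent_sum i = (\<Sum>j<i. CARD('a) ^ Suc j)"

text \<open>L_n is T^(q + ... + q^n) times this principal unit; only the unit survives in the
  limit.\<close>

definition L_unit :: "nat \<Rightarrow> 'a fls" where
  "L_unit n = (\<Prod>j<n. 1 - kT / kT ^ (CARD('a) ^ Suc j))"

lemma carlitz_L_unit: "carlitz_L n = kT ^ exponent_sum n * L_unit n"
  unfolding carlitz_L_def L_unit_def exponent_sum_def power_sum prod.distrib[symmetric]
  by (intro prod.cong) (simp_all add: carlitz_bracket_def right_diff_distrib)

lemma exponent_sum_Suc: "exponent_sum (Suc i) = CARD('a) + CARD('a) * exponent_sum i"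
  unfolding exponent_sum_def sum.lessThan_Suc_shift by (simp add: sum_distrib_left)

lemma exponent_sum_add: "exponent_sum (i + l) = exponent_sum i + CARD('a) ^ i * exponent_sum l"
  by (induction l) (simp_all add: exponent_sum_def algebra_simps power_add)

text \<open>Iteration of Ttil^q = - T Ttil. It explains the leading factor Ttil T of the period: its
  q^i-th power absorbs the sign and the power of T left over in L_N / L_(N-i)^(q^i).\<close>

lemma period_frob: "(Ttil * kT) ^ (CARD('a) ^ i) * (- 1) ^ i = Ttil * kT * kT ^ exponent_sum i"
proof (induction i)
  case (Suc i)
  let ?q = "CARD('a)"
  have "(Ttil * kT) ^ (?q ^ Suc i) * (- 1) ^ Suc i = - (((Ttil * kT) ^ (?q ^ i) * (- 1) ^ i) ^ ?q)"
    by (simp only: power_mult_distrib[of "_ ^ _" "_ ^ _"] frob_neg_one_power power_Suc2[of ?q] power_mult) simp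
  also have "\<dots> = - (Ttil ^ ?q * kT ^ ?q * kT ^ (?q * exponent_sum i))"
    unfolding Suc.IH by (simp add: power_mult_distrib mult.commute flip: power_mult)
  also have "\<dots> = Ttil * kT * kT ^ exponent_sum (Suc i)"
    by (simp add: Ttil_frob exponent_sum_Suc power_add)
  finally show ?case .
qed (simp add: exponent_sum_def)

lemma ord_ge_L_unit_factor: "ord_ge (int n + 1) (kT / kT ^ (CARD('a) ^ Suc n) :: 'a fls)"
proof -
  let ?q = "CARD('a)"
  have "int (Suc n) < int (?q ^ Suc n)"
    unfolding of_nat_less_iff by (rule power_gt_expt) (use card_gt_1[where 'a = 'a] in simp)
  then have "int n + 1 \<le> int (?q ^ Suc n) - 1"
    by (simp del: power_Suc of_nat_power)
  moreover have "1 * (int (?q ^ Suc n) - 1) \<le> (int ?q - 1) * (int (?q ^ Suc n) - 1)"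
    using card_gt_1[where 'a = 'a] by (intro mult_right_mono) (auto simp: int_one_le_iff_zero_less simp del: power_Suc)
  ultimately have le: "int n + 1 \<le> (1 - int ?q) + - (int (?q ^ Suc n) * (1 - int ?q))"
    by (simp add: algebra_simps del: power_Suc)
  have "ord_ge (1 - int ?q) (kT :: 'a fls)" "ord_ge (- (int (?q ^ Suc n) * (1 - int ?q))) (inverse (kT ^ (?q ^ Suc n)) :: 'a fls)"
    by (auto simp: ord_ge_iff_subdegree simp del: power_Suc)
  then show ?thesis unfolding divide_inverse by (rule ord_ge_mult) (rule le)
qed

lemma L_unit_principal: "ord_ge 1 (L_unit n - 1)"
proof (induction n)
  case (Suc n)
  have eq: "L_unit (Suc n) - 1 = L_unit n - 1 - L_unit n * (kT / kT ^ (CARD('a) ^ Suc n))"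
    by (simp add: L_unit_def algebra_simps)
  have "ord_ge 0 (L_unit n)"
    using ord_ge_add[OF ord_ge_mono[OF Suc, of 0] ord_ge_one] by simp
  then show ?case
    unfolding eq by (intro ord_ge_diff[OF Suc] ord_ge_mult0 ord_ge_mono[OF ord_ge_L_unit_factor]) auto
qed (simp add: L_unit_def)

lemma principal_unit:
  fixes x :: "'a fls"
  assumes "ord_ge 1 (x - 1)"
  shows "x \<noteq> 0" "fls_subdegree x = 0" "ord_ge 0 x" "ord_ge 0 (inverse x)"
proof -
  show ge: "ord_ge 0 x" using ord_ge_add[OF ord_ge_mono[OF assms, of 0] ord_ge_one] by simp
  have "x $$ 0 = 1" using ord_geD[OF assms, of 0] by simp
  then show "x \<noteq> 0" and sub: "fls_subdegree x = 0"
    using ge by (auto intro: subdegree_principal_unit)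
  show "ord_ge 0 (inverse x)" by (rule ord_ge_inverse) (simp add: sub)
qed

lemma L_unit_limit:
  obtains P where "L_unit \<longlonglongrightarrow> P" "ord_ge 1 (P - 1)"
proof -
  have ev: "eventually (\<lambda>n. ord_ge k (L_unit (Suc n) - L_unit n)) sequentially" for k
    using eventually_ge_at_top[of "nat k"]
  proof eventually_elim
    case (elim n)
    have "L_unit (Suc n) - L_unit n = - (L_unit n * (kT / kT ^ (CARD('a) ^ Suc n)))"
      by (simp add: L_unit_def algebra_simps)
    then show ?case
      using ord_ge_mult0[OF principal_unit(3)[OF L_unit_principal] ord_ge_mono[OF ord_ge_L_unit_factor, of k n]] elim
      by (simp del: power_Suc)
  qed
  then obtain P where P: "L_unit \<longlonglongrightarrow> P" using fls_Cauchy_convergent by blast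
  moreover have "ord_ge 1 (P - 1)"
    by (rule ord_ge_tendsto[OF P]) (simp_all add: L_unit_principal)
  ultimately show thesis by (rule that)
qed

abbreviation is_period :: "'a fls \<Rightarrow> bool" where
  "is_period w \<equiv>
     (\<forall>z. (\<lambda>N. z * (\<Prod>a\<in>{a::'a poly. a \<noteq> 0 \<and> degree a < N}. (1 - z / (w * iota a)))) \<longlonglongrightarrow> expC z)
     \<and> abs_less (w - Ttil * kT) (Ttil * kT)"

lemma subdegree_Ttil_kT: "fls_subdegree (Ttil * kT) = - int CARD('a)"
  by simp

text \<open>
  In the expansion of the finite products, the coefficient of \<open>z^(q^i) / D_i\<close> is a quotient of
  principal units that tends to 1.
\<close>

lemma period_exists: "\<exists>w. is_period w"
proof -
  let ?q = "CARD('a)"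
  obtain P where P: "L_unit \<longlonglongrightarrow> P" "ord_ge 1 (P - 1)" by (rule L_unit_limit)
  note Pu = principal_unit[OF P(2)] and Lu = principal_unit[OF L_unit_principal]
  \<comment> \<open>The classical product for the Carlitz period: Ttil T divided by the product of 1
    - T^(1 - q^j) over j \<ge> 1.\<close>
  define w where "w = Ttil * kT / P"
  have [simp]: "w \<noteq> 0" using Pu by (simp add: w_def)
  define g where "g N i = (if i \<le> N then L_unit N / P * (P / L_unit (N - i)) ^ (?q ^ i) else 1)" for N i
  have prod: "z * (\<Prod>a\<in>{a::'a poly. a \<noteq> 0 \<and> degree a < N}. (1 - z / (w * iota a))) =
      (\<Sum>i\<le>N. g N i * (z ^ (?q ^ i) / iota (D i)))" for z N
  proof -
    have set: "{a::'a poly. a \<noteq> 0 \<and> degree a < N} = polys_below N - {0}"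
      by (auto simp: polys_below_def)
    show ?thesis unfolding set lattice_product_expand[OF \<open>w \<noteq> 0\<close>]
    proof (rule sum.cong)
      fix i assume "i \<in> {..N}"
      then obtain l where N: "N = i + l" by (metis atMost_iff le_Suc_ex)
      define R where "R = L_unit N"
      define S where "S = L_unit l ^ (?q ^ i)"
      define U where "U = P ^ (?q ^ i)"
      define E where "E = (kT ^ exponent_sum i :: 'a fls)"
      define F where "F = (kT ^ exponent_sum l :: 'a fls) ^ (?q ^ i)"
      define V where "V = (Ttil * kT) ^ (?q ^ i)"
      define s where "s = ((- 1) ^ i :: 'a fls)"
      have nz: "R \<noteq> 0" "S \<noteq> 0" "U \<noteq> 0" "E \<noteq> 0" "F \<noteq> 0" "V \<noteq> 0" "P \<noteq> 0"
        using Pu Lu by (simp_all add: R_def S_def U_def E_def F_def V_def)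
      have V: "V * s = Ttil * kT * E" unfolding V_def s_def E_def by (rule period_frob)
      have LN: "carlitz_L N = E * F * R"
        by (simp add: carlitz_L_unit E_def F_def R_def N exponent_sum_add power_add mult.commute flip: power_mult)
      have Ll: "carlitz_L (N - i) ^ (?q ^ i) = F * S"
        by (simp add: carlitz_L_unit F_def S_def N power_mult_distrib)
      have s2: "s * s = 1" by (simp add: s_def flip: power_mult_distrib)
      have Ttil_s: "Ttil * kT * s * E = V"
      proof -
        have "Ttil * kT * s * E = V * (s * s)" using V by (simp add: mult_ac)
        then show ?thesis by (simp add: s2)
      qed
      have zw: "w * (z / w) ^ (?q ^ i) = (Ttil * kT / P) * (z ^ (?q ^ i) * U / V)"
        unfolding w_def V_def U_def power_divide by simp
      have cancel: "(A / P) * (Z * U / V) * (s * (E * F * R) / (d * (F * S))) =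
                    (A * s * E) * (Z * U * R) / (P * V * (d * S))" for A Z d
        using nz by (cases "d = 0") (simp_all add: field_simps)
      have "w * (z / w) ^ (?q ^ i) * (s * carlitz_L N / (iota (D i) * carlitz_L (N - i) ^ (?q ^ i))) =
            V * (z ^ (?q ^ i) * U * R) / (P * V * (iota (D i) * S))"
        unfolding LN Ll zw cancel Ttil_s ..
      also have "\<dots> = R / P * (U / S) * (z ^ (?q ^ i) / iota (D i))"
        using nz by (simp add: mult_ac)
      also have "\<dots> = g N i * (z ^ (?q ^ i) / iota (D i))"
        by (simp add: g_def N R_def U_def S_def power_divide)
      finally show "w * (z / w) ^ (?q ^ i) *
          ((- 1) ^ i * carlitz_L N / (iota (D i) * carlitz_L (N - i) ^ (?q ^ i))) =
          g N i * (z ^ (?q ^ i) / iota (D i))" by (simp only: s_def)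
    qed simp
  qed
  have "(\<lambda>N. L_unit N * inverse P) \<longlonglongrightarrow> P * inverse P"
    by (intro tendsto_mult P tendsto_const)
  then have lim1: "(\<lambda>N. L_unit N / P) \<longlonglongrightarrow> 1" using Pu by (simp add: divide_inverse)
  have lim2: "(\<lambda>N. P / L_unit N) \<longlonglongrightarrow> 1"
    unfolding tendsto_fls_iff
  proof
    fix k
    have "eventually (\<lambda>N. ord_ge k (L_unit N - P)) sequentially"
      using P(1) by (simp add: tendsto_fls_iff)
    then show "eventually (\<lambda>N. ord_ge k (P / L_unit N - 1)) sequentially"
    proof eventually_elim
      case (elim N)
      have "P / L_unit N - 1 = inverse (L_unit N) * - (L_unit N - P)"
        using Lu by (simp add: field_simps)
      then show ?case using ord_ge_mult0[OF Lu(4)] elim by (simp only: ord_ge_minus_iff)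
    qed
  qed
  have g1: "(\<lambda>N. g N i) \<longlonglongrightarrow> 1" for i
  proof -
    have "(\<lambda>N. P / L_unit (N - i)) \<longlonglongrightarrow> 1"
      using lim2 by (rule filterlim_compose) (rule filterlim_minus_const_nat_at_top)
    then have "(\<lambda>N. L_unit N / P * (P / L_unit (N - i)) ^ (?q ^ i)) \<longlonglongrightarrow> 1 * 1 ^ (?q ^ i)"
      by (intro tendsto_mult lim1 tendsto_fls_power)
    then have "(\<lambda>N. L_unit N / P * (P / L_unit (N - i)) ^ (?q ^ i)) \<longlonglongrightarrow> 1" by simp
    moreover have "eventually (\<lambda>N. L_unit N / P * (P / L_unit (N - i)) ^ (?q ^ i) = g N i) sequentially"
      using eventually_ge_at_top[of i] by eventually_elim (simp add: g_def)
    ultimately show ?thesis by (rule Lim_transform_eventually)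
  qed
  have g0: "ord_ge 0 (g N i)" for N i
    unfolding g_def divide_inverse
    by (auto intro!: ord_ge_mult0 ord_ge_power[where k = 0] Pu Lu)
  have "(\<lambda>N. \<Sum>i\<le>N. g N i * (z ^ (?q ^ i) / iota (D i))) \<longlonglongrightarrow> expC z" for z
    by (rule tendsto_fls_weighted_sum[OF expC_term_eventually expC_sums g1 g0])
  moreover have "abs_less (w - Ttil * kT) (Ttil * kT)"
  proof (cases "w = Ttil * kT")
    case False
    have eq: "w - Ttil * kT = - (Ttil * kT * inverse P * (P - 1))"
      using Pu by (simp add: w_def field_simps)
    with False have nz: "P - 1 \<noteq> 0" by auto
    with P(2) have "fls_subdegree (P - 1) \<ge> 1" by (simp add: ord_ge_iff_subdegree)
    with nz Pu show ?thesis unfolding abs_less_def eq by simp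
  qed (simp add: abs_less_def)
  ultimately have "is_period w" by (simp add: prod)
  then show ?thesis ..
qed

text \<open>For nonzero \<open>a\<close> and N above its degree, the product contains the factor 1 -
  1.\<close>

lemma is_period_expC:
  assumes "is_period w"
  shows "expC (w * iota a) = 0"
proof (cases "w * iota a = 0")
  case False
  have "eventually (\<lambda>N. w * iota a *
          (\<Prod>b\<in>{b::'a poly. b \<noteq> 0 \<and> degree b < N}. (1 - w * iota a / (w * iota b))) = 0) sequentially"
    using eventually_gt_at_top[of "degree a"]
  proof eventually_elim
    case (elim N)
    have "finite {b::'a poly. b \<noteq> 0 \<and> degree b < N}"
      by (rule finite_subset[OF _ finite_polys_below[of N]]) (auto simp: polys_below_def)
    with elim False have "(\<Prod>b\<in>{b::'a poly. b \<noteq> 0 \<and> degree b < N}. (1 - w * iota a / (w * iota b))) = 0"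
      by (intro prod_zero) (auto intro!: bexI[of _ a])
    then show ?case by simp
  qed
  then have "(\<lambda>N. w * iota a *
          (\<Prod>b\<in>{b::'a poly. b \<noteq> 0 \<and> degree b < N}. (1 - w * iota a / (w * iota b)))) \<longlonglongrightarrow> 0"
    by (rule tendsto_eventually)
  moreover from assms have "(\<lambda>N. w * iota a *
          (\<Prod>b\<in>{b::'a poly. b \<noteq> 0 \<and> degree b < N}. (1 - w * iota a / (w * iota b)))) \<longlonglongrightarrow> expC (w * iota a)"
    by blast
  ultimately show ?thesis using LIMSEQ_unique by blast
next
  case True
  then show ?thesis using expC_const_mult[of 0 0] by (simp only: fls_const_0 mult_zero_left)
qed

lemma is_period_ord: "is_period w \<Longrightarrow> ord_ge (1 - int CARD('a)) (w - Ttil * kT)"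
  using subdegree_Ttil_kT by (auto simp: abs_less_def ord_ge_iff_subdegree)

text \<open>Two periods share the leading term Ttil T, so their difference y has order at least 1 -
  q, where exp_C(y) and y have the same leading term; but exp_C(y) = 0.\<close>

lemma period_unique:
  assumes "is_period v" "is_period w" shows "v = w"
proof (rule ccontr)
  assume "v \<noteq> w"
  define y where "y = v - w"
  have 0: "expC y = 0"
    using is_period_expC[OF assms(1), of 1] is_period_expC[OF assms(2), of 1] by (simp add: y_def expC_diff)
  have "ord_ge (1 - int CARD('a)) y"
    unfolding y_def by (rule ord_ge_trans[OF is_period_ord[OF assms(1)] ord_ge_sym[OF is_period_ord[OF assms(2)]]])
  then have "fls_subdegree y \<ge> 1 - int CARD('a)" "ord_ge (fls_subdegree y) y"
    using \<open>v \<noteq> w\<close> by (auto simp: ord_ge_iff_subdegree y_def)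
  then have "ord_ge (fls_subdegree y + 1) (expC y - y)" by (intro ord_ge_expC_diff)
  then have "ord_ge (fls_subdegree y + 1) y" by (simp add: 0)
  then show False using \<open>v \<noteq> w\<close> by (simp add: ord_ge_iff_subdegree y_def)
qed

lemma is_period_varpi: "is_period (varpi Ttil)"
  unfolding varpi_def by (rule theI', rule ex_ex1I[OF period_exists]) (rule period_unique)

section \<open>Functional equation and leading term of the function e\<close>

lemma ee_add: "ee Ttil (x + y) = ee Ttil x + ee Ttil y"
  by (simp add: ee_def distrib_left expC_add)

lemma ee_const_mult: "ee Ttil (fls_const c * x) = fls_const c * ee Ttil x"
  using expC_const_mult[of c "varpi Ttil * x"] by (simp add: ee_def mult_ac)

lemma ee_0 [simp]: "ee Ttil 0 = 0"
  using ee_const_mult[of 0 0] by simp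

lemma ee_iota [simp]: "ee Ttil (iota p) = 0"
  unfolding ee_def by (rule is_period_expC[OF is_period_varpi])

lemma ee_kT: "ee Ttil (kT * x) = kT * ee Ttil x + ee Ttil x ^ CARD('a)"
  using expC_kT[of "varpi Ttil * x"] by (simp add: ee_def mult_ac)

lemma ee_sum: "ee Ttil (\<Sum>i\<in>A. h i) = (\<Sum>i\<in>A. ee Ttil (h i))"
  by (induction A rule: infinite_finite_induct) (simp_all add: ee_add)

text \<open>The period has order at least -q, so \<open>m \<ge> 1\<close> brings
  \<open>varpi Ttil * x\<close> into the range where exp_C is close to the identity.\<close>

lemma ord_ge_ee_diff:
  assumes x: "ord_ge m x" and m: "m \<ge> 1"
  shows "ord_ge (m + 1 - int CARD('a)) (ee Ttil x - Ttil * kT * x)"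
proof -
  let ?w = "varpi Ttil"
  have d: "ord_ge (1 - int CARD('a)) (?w - Ttil * kT)" by (rule is_period_ord[OF is_period_varpi])
  have "ord_ge (- int CARD('a)) (Ttil * kT)" using subdegree_Ttil_kT by (simp add: ord_ge_iff_subdegree)
  from ord_ge_add[OF this ord_ge_mono[OF d]] have "ord_ge (- int CARD('a)) ?w" by simp
  then have "ord_ge (m - int CARD('a)) (?w * x)" using x by (rule ord_ge_mult) simp
  then have 1: "ord_ge (m - int CARD('a) + 1) (ee Ttil x - ?w * x)"
    unfolding ee_def using m by (intro ord_ge_expC_diff) auto
  have 2: "ord_ge (m + 1 - int CARD('a)) (?w * x - Ttil * kT * x)"
    unfolding left_diff_distrib[symmetric] by (rule ord_ge_mult[OF d x]) simp
  from 1 have "ord_ge (m + 1 - int CARD('a)) (ee Ttil x - ?w * x)" by (simp add: algebra_simps)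
  then show ?thesis using 2 by (rule ord_ge_trans)
qed

end

section \<open>The coefficients of the dual exponential\<close>

text \<open>Coefficients of the partial products for the reciprocal of the Anderson-Thakur function,
  without the factor 1 / Ttil.\<close>

definition omega_coeff :: "nat \<Rightarrow> nat \<Rightarrow> 'a::{finite,field} fls" where
  "omega_coeff N m = fps_nth (\<Prod>i<N. (1 - fps_const (inverse (kT ^ (CARD('a) ^ i))) * fps_X)) m"

lemma omega_coeff_0_left: "omega_coeff 0 m = (if m = 0 then 1 else 0)"
  by (simp add: omega_coeff_def)

lemma omega_coeff_0_right [simp]: "omega_coeff N 0 = 1"
  by (induction N) (simp_all add: omega_coeff_def)

lemma omega_coeff_Suc_Suc:
  "omega_coeff (Suc N) (Suc m) =
     omega_coeff N (Suc m) - omega_coeff N m * inverse (kT ^ (CARD('a) ^ N) :: 'a::{finite,field} fls)"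
proof -
  let ?F = "\<Prod>i<N. (1 - fps_const (inverse (kT ^ (CARD('a) ^ i) :: 'a fls)) * fps_X)"
  have "?F * (1 - fps_const (inverse (kT ^ (CARD('a) ^ N))) * fps_X) =
        ?F - fps_const (inverse (kT ^ (CARD('a) ^ N))) * (fps_X * ?F)"
    by (simp add: algebra_simps)
  then show ?thesis
    by (simp add: omega_coeff_def mult.commute del: prod.lessThan_Suc add: prod.lessThan_Suc[of _ N])
qed

text \<open>Here the factor \<open>i = 0\<close> is split off, the others forming the Frobenius
  twist of the shorter product, whereas \<open>omega_coeff_Suc_Suc\<close> splits off the last
  factor. In the limit this version becomes the recursion for alpha.\<close>

lemma omega_coeff_frob:
  "omega_coeff (Suc N) (Suc m) =
     omega_coeff N (Suc m) ^ CARD('a) - omega_coeff N m ^ CARD('a) * inverse (kT :: 'a::{finite,field} fls)"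
proof (induction N arbitrary: m)
  case 0
  show ?case using card_gt_1[where 'a = 'a] by (simp add: omega_coeff_Suc_Suc omega_coeff_0_left)
next
  case (Suc N)
  let ?q = "CARD('a)"
  have q: "inverse (kT ^ (?q ^ Suc N)) = (inverse (kT ^ (?q ^ N)) :: 'a fls) ^ ?q"
    by (simp add: power_inverse mult.commute flip: power_mult)
  let ?i = "inverse (kT ^ (?q ^ N)) :: 'a fls" and ?o = "omega_coeff :: nat \<Rightarrow> nat \<Rightarrow> 'a fls"
  have "?o (Suc (Suc N)) (Suc m) = (?o N (Suc m) ^ ?q - ?o N m ^ ?q * inverse kT) - ?o (Suc N) m * ?i ^ ?q"
    by (simp only: omega_coeff_Suc_Suc[of "Suc N"] Suc.IH q)
  also have "\<dots> = (?o N (Suc m) - ?o N m * ?i) ^ ?q - ?o (Suc N) m ^ ?q * inverse kT"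
  proof (cases m)
    case (Suc k)
    have 1: "?o (Suc N) (Suc k) ^ ?q = ?o N (Suc k) ^ ?q - ?o N k ^ ?q * ?i ^ ?q"
      by (simp only: omega_coeff_Suc_Suc[of N k] frob_diff power_mult_distrib)
    have 2: "?o (Suc N) (Suc k) = ?o N (Suc k) ^ ?q - ?o N k ^ ?q * inverse kT"
      by (rule Suc.IH)
    show ?thesis
      unfolding Suc frob_diff power_mult_distrib 1 unfolding 2 by (simp add: algebra_simps)
  qed (simp add: frob_diff)
  finally show ?case by (simp only: omega_coeff_Suc_Suc[of N])
qed

lemma omega_coeff_eq_0: "N < m \<Longrightarrow> omega_coeff N m = 0"
proof (induction N arbitrary: m)
  case (Suc N)
  then show ?case by (cases m) (simp_all add: omega_coeff_Suc_Suc)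
qed (simp add: omega_coeff_0_left)

lemma ord_ge_X_power: "m \<le> int n \<Longrightarrow> ord_ge m (fls_X ^ n :: 'a::field fls)"
  by (simp add: ord_ge_iff_subdegree)

text \<open>Up to sign this coefficient is an elementary symmetric function of the T^(-q^i). Its
  dominant term takes i = 0, ..., m - 1, and (q - 1)(1 + q + ... + q^(m-1)) = q^m - 1. The signs
  cancel since T^(-q^i) = - X^((q-1) q^i).\<close>

lemma ord_ge_omega_coeff_diff:
  fixes m N :: nat
  assumes "m \<le> N"
  shows "ord_ge (int (CARD('a) ^ m)) (omega_coeff N m - fls_X ^ (CARD('a) ^ m - 1) :: 'a::{finite,field} fls)"
  using assms
proof (induction N arbitrary: m)
  case (Suc N)
  let ?q = "CARD('a)"
  have q: "?q > 1" by (rule card_gt_1)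
  show ?case
  proof (cases m)
    case m: (Suc k)
    then have k: "k \<le> N" using Suc.prems by simp
    let ?X = "fls_X :: 'a fls"
    have rec: "omega_coeff (Suc N) m = omega_coeff N m + omega_coeff N k * ?X ^ ((?q - 1) * ?q ^ N)"
      unfolding m omega_coeff_Suc_Suc inverse_kT_frob by simp
    have mono: "?q ^ k \<le> ?q ^ N" using k q by (simp add: power_increasing)
    show ?thesis
    proof (cases "N = k")
      case True
      have "?q ^ m - 1 = (?q ^ k - 1) + (?q - 1) * ?q ^ k"
        using q by (simp add: m algebra_simps diff_mult_distrib)
      then have "?X ^ (?q ^ m - 1) = ?X ^ (?q ^ k - 1) * ?X ^ ((?q - 1) * ?q ^ k)"
        by (simp only: power_add)
      then have eq: "omega_coeff (Suc N) m - ?X ^ (?q ^ m - 1) =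
          (omega_coeff N k - ?X ^ (?q ^ k - 1)) * ?X ^ ((?q - 1) * ?q ^ k)"
        unfolding rec by (simp add: True m omega_coeff_eq_0 left_diff_distrib)
      show ?thesis unfolding eq
        by (rule ord_ge_mult[OF Suc.IH[OF k] ord_ge_X_power[OF order_refl]])
           (use q in \<open>simp add: m of_nat_diff algebra_simps\<close>)
    next
      case False
      then have le: "m \<le> N" using k m by simp
      have 1: "ord_ge 0 (omega_coeff N k :: 'a fls)"
        using ord_ge_add[OF ord_ge_mono[OF Suc.IH[OF k], of 0] ord_ge_X_power[of 0 "?q ^ k - 1"]] by simp
      have "?q ^ m \<le> ?q ^ N" using le q by (simp add: power_increasing)
      also have "?q ^ N \<le> (?q - 1) * ?q ^ N" using q by simp
      finally have "int (?q ^ m) \<le> int ((?q - 1) * ?q ^ N)" by (simp only: of_nat_le_iff)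
      then have "ord_ge (int (?q ^ m)) (omega_coeff N k * ?X ^ ((?q - 1) * ?q ^ N))"
        by (intro ord_ge_mult0 1 ord_ge_X_power) simp
      from ord_ge_add[OF Suc.IH[OF le] this] show ?thesis
        unfolding rec by (simp add: algebra_simps)
    qed
  qed simp
qed (simp add: omega_coeff_0_left)

lemma ord_ge_0_omega_coeff: "ord_ge 0 (omega_coeff N m :: 'a::{finite,field} fls)"
proof (cases "m \<le> N")
  case True
  show ?thesis
    using ord_ge_add[OF ord_ge_mono[OF ord_ge_omega_coeff_diff[OF True, where 'a = 'a], of 0] ord_ge_X_power[of 0 "CARD('a) ^ m - 1"]]
    by simp
qed (simp add: omega_coeff_eq_0)

lemma omega_coeff_convergent:
  "\<exists>L. (\<lambda>N. omega_coeff N m :: 'a::{finite,field} fls) \<longlonglongrightarrow> L"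
proof (cases m)
  case (Suc j)
  have "eventually (\<lambda>N. ord_ge k (omega_coeff (Suc N) m - omega_coeff N m :: 'a fls)) sequentially" for k
    using eventually_ge_at_top[of "nat k"]
  proof eventually_elim
    case (elim N)
    let ?q = "CARD('a)"
    have q: "?q > 1" by (rule card_gt_1)
    have "N \<le> ?q ^ N" using power_gt_expt[of ?q N] q by simp
    also have "?q ^ N \<le> (?q - 1) * ?q ^ N" using q by simp
    finally have "k \<le> int ((?q - 1) * ?q ^ N)" using elim by linarith
    then have "ord_ge k (omega_coeff N j * fls_X ^ ((?q - 1) * ?q ^ N) :: 'a fls)"
      by (intro ord_ge_mult0 ord_ge_0_omega_coeff ord_ge_X_power)
    then show ?case
      unfolding Suc omega_coeff_Suc_Suc inverse_kT_frob by simp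
  qed
  then show ?thesis by (rule fls_Cauchy_convergent) blast
qed (auto intro: tendsto_const)

context carlitz
begin

lemma omega_coeff_tendsto_alpha:
  "(\<lambda>N. inverse Ttil * omega_coeff N m) \<longlonglongrightarrow> alpha Ttil m"
proof -
  obtain om :: "nat \<Rightarrow> 'a fls" where om: "\<And>m. (\<lambda>N. omega_coeff N m) \<longlonglongrightarrow> om m"
    using omega_coeff_convergent by metis
  let ?lim = "\<lambda>P. \<forall>m. (\<lambda>N. inverse Ttil * omega_coeff N m) \<longlonglongrightarrow> fps_nth P m"
  have eq: "fps_nth (fps_const (inverse Ttil) *
      (\<Prod>i<N. (1 - fps_const (inverse (kT ^ (CARD('a) ^ i))) * fps_X))) m = inverse Ttil * omega_coeff N m" for N m
    by (simp add: omega_coeff_def)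
  have "?lim (alpha_fps Ttil)"
    unfolding alpha_fps_def eq
  proof (rule theI)
    show "?lim (Abs_fps (\<lambda>m. inverse Ttil * om m))"
      by (auto intro!: tendsto_mult om)
    then show "P = Abs_fps (\<lambda>m. inverse Ttil * om m)" if "?lim P" for P
      using that by (intro fps_ext) (metis LIMSEQ_unique)
  qed
  then show ?thesis by (simp add: alpha_def)
qed

lemma alpha_rec:
  "alpha Ttil m = (case m of 0 \<Rightarrow> 0 | Suc k \<Rightarrow> alpha Ttil k ^ CARD('a)) - kT * alpha Ttil m ^ CARD('a)"
proof (cases m)
  case 0
  have "alpha Ttil 0 = inverse Ttil"
    using omega_coeff_tendsto_alpha[of 0] by (simp add: LIMSEQ_const_iff)
  moreover have "inverse Ttil = 0 - kT * inverse Ttil ^ CARD('a)"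
    unfolding power_inverse Ttil_frob by simp
  ultimately show ?thesis using 0 by (simp only: nat.case)
next
  case (Suc k)
  let ?q = "CARD('a)" and ?t = "\<lambda>N m. inverse Ttil * omega_coeff N m"
  have "(\<lambda>N. ?t (Suc N) m) \<longlonglongrightarrow> alpha Ttil m"
    using omega_coeff_tendsto_alpha by (rule LIMSEQ_Suc)
  moreover have "?t (Suc N) m = ?t N k ^ ?q - kT * ?t N m ^ ?q" for N
  proof -
    \<comment> \<open>Rewriting the prefactor in this way makes every occurrence of it a q-th
      power.\<close>
    have "- kT * inverse Ttil ^ ?q = inverse Ttil"
      unfolding power_inverse Ttil_frob by simp
    then have *: "inverse Ttil = - kT * inverse Ttil ^ ?q" by simp
    have "?t (Suc N) m = (- kT * inverse Ttil ^ ?q) * (omega_coeff N m ^ ?q - omega_coeff N k ^ ?q * inverse kT)"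
      unfolding Suc omega_coeff_frob * [symmetric] ..
    then show ?thesis by (simp add: power_mult_distrib algebra_simps)
  qed
  moreover have "(\<lambda>N. ?t N k ^ ?q - kT * ?t N m ^ ?q) \<longlonglongrightarrow> alpha Ttil k ^ ?q - kT * alpha Ttil m ^ ?q"
    by (intro tendsto_diff tendsto_mult tendsto_const tendsto_fls_power omega_coeff_tendsto_alpha)
  ultimately have "alpha Ttil m = alpha Ttil k ^ ?q - kT * alpha Ttil m ^ ?q"
    by (simp only: LIMSEQ_unique)
  then show ?thesis using Suc by simp
qed

lemma ord_ge_inverse_Ttil: "ord_ge 1 (inverse Ttil)"
  by (rule ord_ge_inverse) simp

lemma ord_ge_alpha_diff:
  "ord_ge (int (CARD('a) ^ m) + 1) (alpha Ttil m - fls_X ^ (CARD('a) ^ m - 1) * inverse Ttil)"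
proof (rule ord_ge_tendsto[OF omega_coeff_tendsto_alpha])
  show "eventually (\<lambda>N. ord_ge (int (CARD('a) ^ m) + 1)
      (inverse Ttil * omega_coeff N m - fls_X ^ (CARD('a) ^ m - 1) * inverse Ttil)) sequentially"
    using eventually_ge_at_top[of m]
  proof eventually_elim
    case (elim N)
    have "inverse Ttil * omega_coeff N m - fls_X ^ (CARD('a) ^ m - 1) * inverse Ttil =
        inverse Ttil * (omega_coeff N m - fls_X ^ (CARD('a) ^ m - 1))"
      by (simp add: algebra_simps)
    then show ?case
      using ord_ge_mult[OF ord_ge_inverse_Ttil ord_ge_omega_coeff_diff[OF elim]] by simp
  qed
qed simp

lemma ord_ge_alpha_main: "ord_ge (int (CARD('a) ^ m)) (fls_X ^ (CARD('a) ^ m - 1) * inverse Ttil)"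
  by (rule ord_ge_mult[OF ord_ge_X_power[OF order_refl] ord_ge_inverse_Ttil]) (simp add: of_nat_diff)

lemma ord_ge_alpha: "ord_ge (int (CARD('a) ^ m)) (alpha Ttil m)"
  using ord_ge_add[OF ord_ge_mono[OF ord_ge_alpha_diff[of m], of "int (CARD('a) ^ m)"] ord_ge_alpha_main[of m]]
  by simp

section \<open>Pairing the coefficients with orbits of the Carlitz action\<close>

text \<open>Iterates under the Carlitz action of T. The bound -1 is the one that e satisfies on
  fractions of negative degree; it suffices for convergence against alpha_j, of order at least
  q^j.\<close>

definition carlitz_orbit :: "(nat \<Rightarrow> 'a fls) \<Rightarrow> bool" where
  "carlitz_orbit y \<longleftrightarrow> (\<forall>j. ord_ge (- 1) (y j) \<and> y (Suc j) = kT * y j + y j ^ CARD('a))"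

text \<open>The sum S m n, for an abstract orbit in place of e(T^j x).\<close>

definition pairing :: "nat \<Rightarrow> nat \<Rightarrow> (nat \<Rightarrow> 'a fls) \<Rightarrow> 'a fls" where
  "pairing m n y = (\<Sum>j. alpha Ttil j ^ (CARD('a) ^ m) * y j ^ (CARD('a) ^ n))"

lemma carlitz_orbit_Suc: "carlitz_orbit y \<Longrightarrow> carlitz_orbit (\<lambda>j. y (Suc j))"
  unfolding carlitz_orbit_def by blast

lemma ord_ge_pairing_term:
  assumes "ord_ge l y"
  shows "ord_ge (int (CARD('a) ^ (m + j)) + int (CARD('a) ^ n) * l) (alpha Ttil j ^ (CARD('a) ^ m) * y ^ (CARD('a) ^ n))"
  by (rule ord_ge_mult[OF ord_ge_power[OF ord_ge_alpha order_refl] ord_ge_power[OF assms order_refl]])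
     (simp add: power_add)

lemma pairing_sums:
  assumes "carlitz_orbit y"
  shows "(\<lambda>j. alpha Ttil j ^ (CARD('a) ^ m) * y j ^ (CARD('a) ^ n)) sums pairing m n y"
  unfolding pairing_def
proof (intro summable_sums summable_fls)
  fix k
  show "eventually (\<lambda>j. ord_ge k (alpha Ttil j ^ (CARD('a) ^ m) * y j ^ (CARD('a) ^ n))) sequentially"
    using eventually_ge_at_top[of "nat (k + int (CARD('a) ^ n))"]
  proof eventually_elim
    case (elim j)
    have "m + j < CARD('a) ^ (m + j)" by (rule power_gt_expt) (use card_gt_1[where 'a = 'a] in simp)
    with elim have "k \<le> int (CARD('a) ^ (m + j)) + int (CARD('a) ^ n) * - 1" by linarith
    then show ?case
      using assms by (intro ord_ge_mono[OF ord_ge_pairing_term[where l = "- 1"]]) (auto simp: carlitz_orbit_def)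
  qed
qed

lemma pairing_shift:
  assumes "carlitz_orbit y"
  shows "pairing m n (\<lambda>j. y (Suc j)) = kT ^ (CARD('a) ^ n) * pairing m n y + pairing m (Suc n) y"
proof -
  let ?q = "CARD('a)"
  have "alpha Ttil j ^ (?q ^ m) * y (Suc j) ^ (?q ^ n) =
      kT ^ (?q ^ n) * (alpha Ttil j ^ (?q ^ m) * y j ^ (?q ^ n)) +
      alpha Ttil j ^ (?q ^ m) * y j ^ (?q ^ Suc n)" for j
  proof -
    have "y (Suc j) ^ (?q ^ n) = kT ^ (?q ^ n) * y j ^ (?q ^ n) + y j ^ (?q ^ Suc n)"
      using assms by (simp add: carlitz_orbit_def frob_add_pow power_mult_distrib flip: power_mult)
    then show ?thesis by (simp add: algebra_simps)
  qed
  moreover have "(\<lambda>j. kT ^ (?q ^ n) * (alpha Ttil j ^ (?q ^ m) * y j ^ (?q ^ n)) +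
      alpha Ttil j ^ (?q ^ m) * y j ^ (?q ^ Suc n)) sums
      (kT ^ (?q ^ n) * pairing m n y + pairing m (Suc n) y)"
    by (intro sums_add sums_fls_mult pairing_sums assms)
  ultimately have "(\<lambda>j. alpha Ttil j ^ (?q ^ m) * y (Suc j) ^ (?q ^ n)) sums
      (kT ^ (?q ^ n) * pairing m n y + pairing m (Suc n) y)" by (simp only:)
  with pairing_sums[OF carlitz_orbit_Suc[OF assms], of m n] show ?thesis by (rule sums_unique2)
qed

text \<open>Summation by parts: the recursion of alpha moves the index shift from alpha to
  \<open>y\<close>.\<close>

lemma pairing_alpha_rec:
  assumes "carlitz_orbit y"
  shows "pairing m n y = pairing (Suc m) n (\<lambda>j. y (Suc j)) - kT ^ (CARD('a) ^ m) * pairing (Suc m) n y"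
proof -
  let ?q = "CARD('a)"
  let ?g = "\<lambda>j. case j of 0 \<Rightarrow> 0 | Suc i \<Rightarrow> alpha Ttil i ^ (?q ^ Suc m) * y (Suc i) ^ (?q ^ n)"
  have "?g sums (pairing (Suc m) n (\<lambda>j. y (Suc j)) + ?g 0)"
    by (rule sums_Suc) (simp add: pairing_sums[OF carlitz_orbit_Suc[OF assms]] del: power_Suc)
  then have "(\<lambda>j. ?g j - kT ^ (?q ^ m) * (alpha Ttil j ^ (?q ^ Suc m) * y j ^ (?q ^ n))) sums
      (pairing (Suc m) n (\<lambda>j. y (Suc j)) - kT ^ (?q ^ m) * pairing (Suc m) n y)"
    by (intro sums_fls_diff sums_fls_mult pairing_sums assms) simp
  moreover have "?g j - kT ^ (?q ^ m) * (alpha Ttil j ^ (?q ^ Suc m) * y j ^ (?q ^ n)) =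
      alpha Ttil j ^ (?q ^ m) * y j ^ (?q ^ n)" for j
  proof -
    have "alpha Ttil j ^ (?q ^ m) =
        (case j of 0 \<Rightarrow> 0 | Suc i \<Rightarrow> alpha Ttil i ^ ?q) ^ (?q ^ m) - kT ^ (?q ^ m) * alpha Ttil j ^ (?q ^ Suc m)"
      by (subst alpha_rec) (simp add: frob_diff_pow power_mult_distrib flip: power_mult)
    then show ?thesis
      by (cases j) (simp_all only: nat.case left_diff_distrib power_mult[symmetric] power_Suc mult.assoc,
                    simp_all add: zero_power)
  qed
  ultimately have "(\<lambda>j. alpha Ttil j ^ (?q ^ m) * y j ^ (?q ^ n)) sums
      (pairing (Suc m) n (\<lambda>j. y (Suc j)) - kT ^ (?q ^ m) * pairing (Suc m) n y)" by (simp only:)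
  with pairing_sums[OF assms, of m n] show ?thesis by (rule sums_unique2)
qed

lemma pairing_frob:
  assumes "carlitz_orbit y"
  shows "pairing (Suc m) (Suc n) y = pairing m n y ^ CARD('a)"
proof -
  have "(\<lambda>j. (alpha Ttil j ^ (CARD('a) ^ m) * y j ^ (CARD('a) ^ n)) ^ CARD('a)) sums (pairing m n y ^ CARD('a))"
    using sums_frob[OF pairing_sums[OF assms, of m n], of 1] by simp
  then show ?thesis
    using pairing_sums[OF assms, of "Suc m" "Suc n"]
    by (simp add: power_mult_distrib mult.commute[of "CARD('a)"] power_mult sums_unique2)
qed

text \<open>After the recursion of alpha and then that of \<open>y\<close>, the two terms with
  factor T cancel, and both factors are left with one Frobenius twist.\<close>

lemma pairing_0_0_frob:
  assumes "carlitz_orbit y"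
  shows "pairing 0 0 y ^ CARD('a) = pairing 0 0 y"
proof -
  have "pairing 0 0 y = pairing (Suc 0) (Suc 0) y"
    using pairing_alpha_rec[OF assms, of 0 0] pairing_shift[OF assms, of "Suc 0" 0] by simp
  then show ?thesis using pairing_frob[OF assms, of 0 0] by simp
qed

lemma pairing_0_Suc_frob:
  assumes "carlitz_orbit y"
  shows "pairing 0 (Suc n) y =
    carlitz_bracket (Suc n) * pairing 0 n y ^ CARD('a) + pairing 0 (Suc n) y ^ CARD('a)"
  unfolding pairing_frob[OF assms, symmetric] carlitz_bracket_def
  by (subst pairing_alpha_rec[OF assms])
     (simp add: pairing_shift[OF assms] algebra_simps del: power_Suc)

text \<open>Terms with j \<noteq> n lie in the maximal ideal: for j < n because \<open>y j\<close>
  is integral, for j > n because q^j exceeds the pole order q^n. At j = n the leading term X^(q^n -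
  1) / Ttil of alpha_n meets (Ttil c)^(q^n), and their product is c.\<close>

lemma ord_ge_pairing_diff:
  assumes y: "carlitz_orbit y"
    and small: "\<And>j. j < n \<Longrightarrow> ord_ge (int (n + 1 - j) * (int CARD('a) - 1) - int CARD('a)) (y j)"
    and lead: "ord_ge 0 (y n - Ttil * fls_const c)"
  shows "ord_ge 1 (pairing 0 n y - fls_const c)"
proof -
  let ?q = "CARD('a)"
  have q: "?q > 1" by (rule card_gt_1)
  have "(\<lambda>j. alpha Ttil j ^ (?q ^ 0) * y j ^ (?q ^ n) - (if j = n then fls_const c else 0)) sums
      (pairing 0 n y - fls_const c)"
    by (intro sums_fls_diff pairing_sums y sums_single)
  then show ?thesis
  proof (rule ord_ge_sums)
    fix j
    consider "j < n" | "j = n" | "j > n" by linarith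
    then show "ord_ge 1 (alpha Ttil j ^ (?q ^ 0) * y j ^ (?q ^ n) - (if j = n then fls_const c else 0))"
    proof cases
      case 1
      define l where "l = int (n + 1 - j) * (int ?q - 1) - int ?q"
      \<comment> \<open>For \<open>j < n\<close> the factor \<open>n + 1 - j\<close> is at least 2,
        and 2 (q - 1) \<ge> q makes \<open>y j\<close> integral.\<close>
      have "2 * (int ?q - 1) \<le> int (n + 1 - j) * (int ?q - 1)"
        using 1 q by (intro mult_right_mono) auto
      moreover have "0 \<le> x - int ?q" if "2 * (int ?q - 1) \<le> x" for x
        using that card_gt_1[where 'a = 'a, unfolded of_nat_less_iff[where 'a = int, symmetric]] by simp
      ultimately have "l \<ge> 0" unfolding l_def by blast
      then have "int (?q ^ n) * l \<ge> 0" by simp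
      moreover have "int (?q ^ (0 + j)) \<ge> 1" by (simp add: int_one_le_iff_zero_less)
      ultimately have "1 \<le> int (?q ^ (0 + j)) + int (?q ^ n) * l" by linarith
      from ord_ge_mono[OF ord_ge_pairing_term[OF small[OF 1], of 0 j n, folded l_def] this] 1
      show ?thesis by simp
    next
      case 3
      then have "?q ^ n < ?q ^ j" using q by (simp add: power_strict_increasing)
      then have "1 \<le> int (?q ^ (0 + j)) + int (?q ^ n) * - 1"
        by (simp del: of_nat_power)
      from ord_ge_mono[OF ord_ge_pairing_term[of "- 1" "y j" 0 j n] this] 3 y
      show ?thesis by (simp add: carlitz_orbit_def)
    next
      case 2
      define A where "A = fls_X ^ (?q ^ n - 1) * inverse Ttil"
      have "Ttil ^ (?q ^ n) * fls_X ^ (?q ^ n - 1) * inverse Ttil = 1"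
        unfolding Ttil_X_power by simp
      then have A: "A * (Ttil * fls_const c) ^ (?q ^ n) = fls_const c"
        by (simp add: A_def power_mult_distrib frob_const_pow mult_ac)
      have eq: "alpha Ttil n * y n ^ (?q ^ n) - fls_const c =
          (alpha Ttil n - A) * y n ^ (?q ^ n) + A * (y n - Ttil * fls_const c) ^ (?q ^ n)"
        unfolding frob_diff_pow right_diff_distrib A by (simp add: algebra_simps)
      have "ord_ge (- int (?q ^ n)) (y n ^ (?q ^ n))"
        using y by (intro ord_ge_power[where k = "- 1"]) (auto simp: carlitz_orbit_def)
      then have "ord_ge 1 ((alpha Ttil n - A) * y n ^ (?q ^ n))"
        unfolding A_def by (rule ord_ge_mult[OF ord_ge_alpha_diff]) simp
      moreover have "ord_ge 1 (A * (y n - Ttil * fls_const c) ^ (?q ^ n))"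
        unfolding A_def
        by (rule ord_ge_mult[OF ord_ge_alpha_main ord_ge_power[OF lead order_refl]])
           (simp add: int_one_le_iff_zero_less)
      ultimately show ?thesis using 2 eq by (simp add: ord_ge_add)
    qed
  qed
qed

lemma pairing_eq_const_if_frob:
  assumes "carlitz_orbit y" and frob: "pairing 0 n y ^ CARD('a) = pairing 0 n y"
    and "\<And>j. j \<le> n \<Longrightarrow> ord_ge (int (n + 1 - j) * (int CARD('a) - 1) - int CARD('a)) (y j)"
    and "ord_ge 0 (y n - Ttil * fls_const c)"
  shows "pairing 0 n y = fls_const c"
proof -
  obtain d where d: "pairing 0 n y = fls_const d" using frob by (rule frob_fixed_imp_const)
  have "ord_ge 1 (pairing 0 n y - fls_const c)"
    using assms by (intro ord_ge_pairing_diff) auto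
  then have "(fls_const d - fls_const c) $$ 0 = 0" unfolding d by (rule ord_geD) simp
  then show ?thesis by (simp add: d)
qed

lemma pairing_eq_const:
  assumes "carlitz_orbit y"
    and "\<And>j. j \<le> n \<Longrightarrow> ord_ge (int (n + 1 - j) * (int CARD('a) - 1) - int CARD('a)) (y j)"
    and "ord_ge 0 (y n - Ttil * fls_const c)"
  shows "pairing 0 n y = fls_const c"
  using assms(2,3)
proof (induction n arbitrary: c)
  case 0
  then show ?case by (intro pairing_eq_const_if_frob pairing_0_0_frob assms(1))
next
  case (Suc n)
  have q: "CARD('a) > 1" by (rule card_gt_1)
  \<comment> \<open>Under the hypotheses for \<open>Suc n\<close>, \<open>y n\<close> is integral,
    so its constant at the previous index is 0. The bracket term of the recursion then
    vanishes.\<close>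
  have "pairing 0 n y = fls_const 0"
  proof (rule Suc.IH)
    fix j assume "j \<le> n"
    have "int (n + 1 - j) * (int CARD('a) - 1) \<le> int (Suc n + 1 - j) * (int CARD('a) - 1)"
      using q \<open>j \<le> n\<close> by (intro mult_right_mono) auto
    then show "ord_ge (int (n + 1 - j) * (int CARD('a) - 1) - int CARD('a)) (y j)"
      using \<open>j \<le> n\<close> by (intro ord_ge_mono[OF Suc.prems(1)]) auto
  next
    show "ord_ge 0 (y n - Ttil * fls_const 0)"
      using ord_ge_mono[OF Suc.prems(1)[of n], of 0] q by simp
  qed
  then have "pairing 0 (Suc n) y ^ CARD('a) = pairing 0 (Suc n) y"
    using pairing_0_Suc_frob[OF assms(1), of n] q by (simp add: zero_power)
  then show ?case using Suc.prems assms(1) by (intro pairing_eq_const_if_frob) auto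
qed

end

section \<open>Residues and dual families\<close>

lemma Res_add: "Res (x + y) = Res x + Res y"
  by (simp add: Res_def)

lemma Res_const_mult: "Res (fls_const c * x) = c * Res x"
  by (simp add: Res_def)

lemma Res_0 [simp]: "Res 0 = 0"
  by (simp add: Res_def)

lemma Res_sum: "Res (\<Sum>i\<in>A. h i) = (\<Sum>i\<in>A. Res (h i))"
  by (induction A rule: infinite_finite_induct) (simp_all add: Res_add)

text \<open>T^i is up to sign a power of X with exponent at most 0, while Res reads the exponent q -
  1 > 0. Hence Res(p / f) depends only on p modulo f.\<close>

lemma Res_iota [simp]: "Res (iota p) = 0" for p :: "'a::{finite,field} poly"
proof -
  have "Res (kT ^ i :: 'a fls) = 0" for i
  proof -
    have kT: "kT ^ i = (- 1) ^ i * (fls_X_intpow (int i * (1 - int CARD('a))) :: 'a fls)"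
      by (simp only: kT_def fls_X_intpow_power power_minus[of "fls_X_intpow _"])
    have "int i * (1 - int CARD('a)) \<le> 0"
      using card_gt_1[where 'a = 'a] by (simp add: mult_nonneg_nonpos)
    then show ?thesis
      unfolding Res_def kT using card_gt_1[where 'a = 'a] by (cases "even i") auto
  qed
  then show ?thesis by (simp add: iota_altdef Res_sum Res_const_mult)
qed

lemma ord_ge_iota_divide:
  fixes f r :: "'a::{finite,field} poly"
  assumes f: "f \<noteq> 0" and r: "r \<in> polys_below (Suc e)" and e: "e + m = degree f"
  shows "ord_ge (int m * (int CARD('a) - 1)) (iota r / iota f)"
  unfolding divide_inverse
proof (rule ord_ge_mult)
  show "ord_ge (int e * (1 - int CARD('a))) (iota r)"
    using r by (intro ord_ge_iota) (auto simp: polys_below_def)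
  show "ord_ge (- (int (degree f) * (1 - int CARD('a)))) (inverse (iota f))"
    by (rule ord_ge_inverse) (simp add: subdegree_iota[OF f])
  show "int m * (int CARD('a) - 1) \<le> int e * (1 - int CARD('a)) + - (int (degree f) * (1 - int CARD('a)))"
    by (simp add: algebra_simps flip: e)
qed

lemma ord_ge_iota_divide_lead:
  fixes f r :: "'a::{finite,field} poly"
  assumes f: "lead_coeff f = 1" and r: "r \<in> polys_below (Suc e)" and e: "e + Suc m = degree f"
  shows "ord_ge (int CARD('a) - 1) (kT ^ Suc m * (iota r / iota f) - fls_const (coeff r e))"
proof -
  have f0: "f \<noteq> 0" using f by auto
  \<comment> \<open>The multiple of the monic \<open>f\<close> cancels the coefficient in degree deg
    f, leaving a fraction p / f of negative degree.\<close>
  define p where "p = monom 1 (Suc m) * r - smult (coeff r e) f"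
  have "p \<in> polys_below (Suc (e + m))"
    unfolding polys_below_iff
  proof (intro allI impI)
    fix i assume i: "i \<ge> Suc (e + m)"
    show "coeff p i = 0"
    proof (cases "i = degree f")
      case True
      have "coeff (monom 1 (Suc m) * r) i = coeff r e"
        unfolding True e[symmetric] by (simp add: coeff_monom_mult)
      then show ?thesis using f True by (simp add: p_def)
    next
      case False
      with i e have "i > degree f" by simp
      moreover from this have "i - Suc m \<ge> Suc e" using e by simp
      ultimately show ?thesis
        using r by (simp add: p_def coeff_monom_mult coeff_eq_0 polys_below_iff)
    qed
  qed
  then have "ord_ge (int 1 * (int CARD('a) - 1)) (iota p / iota f)"
    by (rule ord_ge_iota_divide[OF f0]) (use e in simp)
  moreover have "iota p / iota f = kT ^ Suc m * (iota r / iota f) - fls_const (coeff r e)"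
    using f0 by (simp add: p_def field_simps)
  ultimately show ?thesis by simp
qed

text \<open>A counting argument: residues against the a_k recover the coefficients of a combination
  of the b_i even modulo f, so the q^(deg f) combinations are distinct modulo f and exhaust A / f.
  The same residues then give the coordinates of p.\<close>

lemma f_dual_expand:
  fixes f :: "'a::{finite,field} poly"
  assumes f: "lead_coeff f = 1" and dual: "f_dual f as bs"
  shows "f dvd p - (\<Sum>i=1..degree f. smult (Res (iota (as i * p) / iota f)) (bs i))"
proof -
  let ?d = "degree f" and ?I = "{1..degree f}"
  have f0: "f \<noteq> 0" using f by auto
  define comb where "comb c = (\<Sum>i\<in>?I. smult (c i) (bs i))" for c
  have res: "Res (iota (as k * (comb c + f * s)) / iota f) = c k" if k: "k \<in> ?I" for c k s
  proof -
    have "iota (as k * (comb c + f * s)) / iota f =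
        (\<Sum>i\<in>?I. fls_const (c i) * (iota (as k * bs i) / iota f)) + iota (as k * s)"
      using f0 by (simp add: comb_def field_simps sum_distrib_left sum_divide_distrib)
    also have "Res \<dots> = (\<Sum>i\<in>?I. c i * Res (iota (as k * bs i) / iota f))"
      unfolding Res_add Res_iota Res_sum Res_const_mult by simp
    also have "\<dots> = (\<Sum>i\<in>?I. if i = k then c i else 0)"
      by (intro sum.cong) (use dual k in \<open>auto simp: f_dual_def\<close>)
    also have "\<dots> = c k" using k by simp
    finally show ?thesis .
  qed
  let ?E = "?I \<rightarrow>\<^sub>E (UNIV :: 'a set)"
  have "inj_on (\<lambda>c. comb c mod f) ?E"
  proof (rule inj_onI)
    fix c c' assume c: "c \<in> ?E" "c' \<in> ?E" and eq: "comb c mod f = comb c' mod f"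
    show "c = c'"
    proof (rule PiE_ext[OF c])
      fix k assume k: "k \<in> ?I"
      have "comb c + f * - (comb c div f) = comb c' + f * - (comb c' div f)"
        using eq by (simp add: minus_mult_div_eq_mod)
      then show "c k = c' k"
        using res[OF k, of c "- (comb c div f)"] res[OF k, of c' "- (comb c' div f)"] by (simp only:)
    qed
  qed
  then have "card ((\<lambda>c. comb c mod f) ` ?E) = card (polys_below ?d :: 'a poly set)"
    by (simp add: card_image card_PiE card_polys_below)
  moreover have "(\<lambda>c. comb c mod f) ` ?E \<subseteq> polys_below ?d"
    using f0 degree_mod_less[of f] by (auto simp: polys_below_def)
  ultimately have "(\<lambda>c. comb c mod f) ` ?E = polys_below ?d"
    by (intro card_subset_eq) auto
  moreover have "p mod f \<in> polys_below ?d"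
    using f0 degree_mod_less[of f] by (auto simp: polys_below_def)
  ultimately have "p mod f \<in> (\<lambda>c. comb c mod f) ` ?E" by (simp only:)
  then obtain c where "p mod f = comb c mod f" by blast
  then have "f dvd p - comb c" by (simp add: mod_eq_dvd_iff)
  then obtain s where "p - comb c = f * s" by (rule dvdE)
  then have s: "p = comb c + f * s" by (simp add: algebra_simps)
  have "(\<Sum>i\<in>?I. smult (Res (iota (as i * p) / iota f)) (bs i)) = comb c"
    unfolding comb_def by (intro sum.cong) (simp_all add: s res del: iota_mult iota_add)
  then show ?thesis using s by simp
qed

section \<open>Orbits of residues modulo \<open>f\<close>\<close>

locale carlitz_modulus = carlitz +
  fixes f :: "'a poly"
  assumes monic: "lead_coeff f = 1"
begin

lemma f_nonzero [simp]: "f \<noteq> 0"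
  using monic by auto

definition orbit :: "'a poly \<Rightarrow> nat \<Rightarrow> 'a fls" where
  "orbit p j = ee Ttil (kT ^ j * (iota p / iota f))"

lemma orbit_cong:
  assumes "f dvd p - r" shows "orbit p = orbit r"
proof
  fix j
  from assms obtain s where "p - r = f * s" by (rule dvdE)
  then have "p = r + f * s" by (simp add: algebra_simps)
  then have "kT ^ j * (iota p / iota f) = kT ^ j * (iota r / iota f) + iota (monom 1 j * s)"
    by (simp add: field_simps)
  then show "orbit p j = orbit r j" unfolding orbit_def by (simp only: ee_add ee_iota add_0_right)
qed

lemma orbit_pCons_0: "orbit (pCons 0 p) j = orbit p (Suc j)"
  by (simp add: orbit_def iota_pCons mult_ac)

lemma orbit_monom_mult: "orbit (monom 1 j * p) 0 = orbit p j"
  by (simp add: orbit_def)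

lemma orbit_0: "orbit 0 j = 0"
  by (simp add: orbit_def)

lemma ord_ge_orbit:
  assumes p: "p \<in> polys_below (Suc e)" and e: "e + Suc n = degree f" and j: "j \<le> n"
  shows "ord_ge (int (n + 1 - j) * (int CARD('a) - 1) - int CARD('a) + 1)
           (orbit p j - Ttil * kT * (kT ^ j * (iota p / iota f)))"
    and "ord_ge (int (n + 1 - j) * (int CARD('a) - 1) - int CARD('a)) (orbit p j)"
proof -
  let ?q = "CARD('a)" and ?x = "kT ^ j * (iota p / iota f)"
  define m where "m = int (n + 1 - j) * (int ?q - 1)"
  have q: "?q > 1" by (rule card_gt_1)
  have "int (n + 1 - j) > 0" using j by simp
  with q have "m > 0" unfolding m_def by (intro mult_pos_pos) auto
  have "m \<le> int j * (1 - int ?q) + int (Suc n) * (int ?q - 1)"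
    using j by (simp add: m_def of_nat_diff algebra_simps)
  then have x: "ord_ge m ?x"
    by (rule ord_ge_mult[OF ord_ge_kT_power[OF order_refl] ord_ge_iota_divide[OF f_nonzero p e]])
  have 1: "ord_ge (m + 1 - int ?q) (orbit p j - Ttil * kT * ?x)"
    unfolding orbit_def using \<open>m > 0\<close> by (intro ord_ge_ee_diff x) simp
  then show "ord_ge (m - int ?q + 1) (orbit p j - Ttil * kT * ?x)" by (simp add: algebra_simps)
  have "ord_ge (- int ?q) (Ttil * kT)"
    using subdegree_Ttil_kT by (simp add: ord_ge_iff_subdegree)
  then have "ord_ge (m - int ?q) (Ttil * kT * ?x)" using x by (rule ord_ge_mult) simp
  from ord_ge_add[OF ord_ge_mono[OF 1] this] show "ord_ge (m - int ?q) (orbit p j)" by simp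
qed

lemma carlitz_orbit: "carlitz_orbit (orbit p)"
  unfolding carlitz_orbit_def
proof (intro allI conjI)
  fix j
  show "orbit p (Suc j) = kT * orbit p j + orbit p j ^ CARD('a)"
    unfolding orbit_def power_Suc mult.assoc by (rule ee_kT)
  \<comment> \<open>Reduction modulo f does not change the value of e and makes the fraction one of
    negative degree, where the bound -1 is available.\<close>
  define r where "r = (monom 1 j * p) mod f"
  have "orbit (monom 1 j * p) = orbit r"
    by (rule orbit_cong) (simp add: r_def minus_mod_eq_mult_div)
  then have eq: "orbit p j = orbit r 0" using orbit_monom_mult[of j p] by simp
  have r: "r \<in> polys_below (degree f)"
    using degree_mod_less[of f] by (auto simp: polys_below_def r_def)
  show "ord_ge (- 1) (orbit p j)"
  proof (cases "degree f")
    case 0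
    then show ?thesis using r by (simp add: eq orbit_0)
  next
    case (Suc e)
    then show ?thesis using ord_ge_orbit(2)[of r e 0 0] r by (simp add: eq)
  qed
qed

text \<open>The value is the coefficient of T^(-n-1) in p / f: for n = 0 the residue that enters
  (i), for e = deg a the leading coefficient 1 of (ii).\<close>

lemma pairing_orbit_eq_coeff:
  assumes p: "p \<in> polys_below (Suc e)" and e: "e + Suc n = degree f"
  shows "pairing 0 n (orbit p) = fls_const (coeff p e)"
proof (rule pairing_eq_const[OF carlitz_orbit])
  show "ord_ge (int (n + 1 - j) * (int CARD('a) - 1) - int CARD('a)) (orbit p j)" if "j \<le> n" for j
    by (rule ord_ge_orbit(2)[OF p e that])
  have 1: "ord_ge 0 (orbit p n - Ttil * kT * (kT ^ n * (iota p / iota f)))"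
    using ord_ge_orbit(1)[OF p e order_refl] by simp
  have "ord_ge 0 (Ttil * (kT ^ Suc n * (iota p / iota f) - fls_const (coeff p e)))"
    by (rule ord_ge_mult[OF _ ord_ge_iota_divide_lead[OF monic p e], where k = "- 1"])
       (use card_gt_1[where 'a = 'a] in \<open>auto simp: ord_ge_iff_subdegree\<close>)
  then have 2: "ord_ge 0 (Ttil * kT * (kT ^ n * (iota p / iota f)) - Ttil * fls_const (coeff p e))"
    by (simp add: algebra_simps)
  show "ord_ge 0 (orbit p n - Ttil * fls_const (coeff p e))"
    by (rule ord_ge_trans[OF 1 2])
qed

text \<open>For p of degree below deg f this is T p mod f, in a form that exhibits the constant
  split off from T p / f.\<close>

definition shift_mod :: "'a poly \<Rightarrow> 'a poly" where
  "shift_mod p = pCons 0 p - smult (coeff p (degree f - 1)) f"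

lemma shift_mod_below:
  assumes "p \<in> polys_below (degree f)" "degree f > 0"
  shows "shift_mod p \<in> polys_below (degree f)"
  unfolding polys_below_iff
proof (intro allI impI)
  fix i assume "i \<ge> degree f"
  then consider "i = degree f" | "i > degree f" by linarith
  then show "coeff (shift_mod p) i = 0"
    using assms monic
    by cases (auto simp: shift_mod_def coeff_pCons polys_below_iff coeff_eq_0 split: nat.splits)
qed

lemma orbit_shift_mod: "orbit (shift_mod p) = (\<lambda>j. orbit p (Suc j))"
proof -
  have "orbit (shift_mod p) = orbit (pCons 0 p)"
    by (rule orbit_cong) (simp add: shift_mod_def dvd_smult)
  then show ?thesis by (auto simp: orbit_pCons_0)
qed

lemma iota_shift_mod_divide:
  "iota (shift_mod p) / iota f = kT * (iota p / iota f) - fls_const (coeff p (degree f - 1))"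
  by (simp add: shift_mod_def iota_pCons diff_divide_distrib)

text \<open>
  The finite set of residues is stable under the shift, so multiplication by \<open>kT\<close>, which lowers
  the valuation, cannot act on a nonzero value of minimal valuation.
\<close>

lemma shift_eigen_imp_0:
  fixes h :: "'a poly \<Rightarrow> 'a fls"
  assumes h: "\<And>p. p \<in> polys_below (degree f) \<Longrightarrow> h (shift_mod p) = kT * h p"
    and d: "degree f > 0" and p: "p \<in> polys_below (degree f)"
  shows "h p = 0"
proof (rule ccontr)
  assume "h p \<noteq> 0"
  define B where "B = {p \<in> polys_below (degree f). h p \<noteq> 0}"
  have "finite B" "B \<noteq> {}" using p \<open>h p \<noteq> 0\<close> by (auto simp: B_def)
  define r where "r = arg_min_on (\<lambda>p. fls_subdegree (h p)) B"
  have "r \<in> B" unfolding r_def by (rule arg_min_if_finite) fact+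
  then have r: "r \<in> polys_below (degree f)" "h r \<noteq> 0" by (auto simp: B_def)
  then have "shift_mod r \<in> B"
    using shift_mod_below[OF r(1) d] by (simp add: B_def h)
  then have "fls_subdegree (h r) \<le> fls_subdegree (h (shift_mod r))"
    unfolding r_def by (rule arg_min_least[OF \<open>finite B\<close> \<open>B \<noteq> {}\<close>])
  then have "fls_subdegree (h r) \<le> fls_subdegree (kT * h r)" by (simp only: h[OF r(1)])
  then show False using r card_gt_1[where 'a = 'a] by simp
qed

lemma pairing_orbit_eq_Psi:
  assumes "p \<in> polys_below (degree f)"
  shows "pairing (Suc m) 0 (orbit p) = - Psi m (iota p / iota f)"
proof (cases "degree f")
  case 0
  then have "p = 0" using assms by simp
  then show ?thesis using card_gt_1[where 'a = 'a] by (simp add: pairing_def orbit_0)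
next
  case (Suc e)
  have rec: "pairing (Suc m) 0 (orbit (shift_mod r)) =
      kT * pairing (Suc m) 0 (orbit r) + pairing m 0 (orbit r) ^ CARD('a)" for m and r :: "'a poly"
    unfolding orbit_shift_mod pairing_shift[OF carlitz_orbit] pairing_frob[OF carlitz_orbit] by simp
  show ?thesis using assms
  proof (induction m arbitrary: p)
    case 0
    have "pairing (Suc 0) 0 (orbit p) + iota p / iota f = 0"
    proof (rule shift_eigen_imp_0[of "\<lambda>p. pairing (Suc 0) 0 (orbit p) + iota p / iota f"])
      fix r :: "'a poly" assume "r \<in> polys_below (degree f)"
      \<comment> \<open>The constant dropped by the reduction is exactly S 0 0, and Frobenius fixes
        it, so the two inhomogeneous terms cancel.\<close>
      then have "pairing 0 0 (orbit r) = fls_const (coeff r e)"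
        using Suc by (intro pairing_orbit_eq_coeff) auto
      then show "pairing (Suc 0) 0 (orbit (shift_mod r)) + iota (shift_mod r) / iota f =
          kT * (pairing (Suc 0) 0 (orbit r) + iota r / iota f)"
        unfolding rec iota_shift_mod_divide by (simp add: Suc frob_const distrib_left)
    qed (use Suc 0 in auto)
    then show ?case by (simp add: eq_neg_iff_add_eq_0)
  next
    case (Suc m)
    have "pairing (Suc (Suc m)) 0 (orbit p) + Psi (Suc m) (iota p / iota f) = 0"
    proof (rule shift_eigen_imp_0[of "\<lambda>p. pairing (Suc (Suc m)) 0 (orbit p) + Psi (Suc m) (iota p / iota f)"])
      fix r :: "'a poly" assume "r \<in> polys_below (degree f)"
      \<comment> \<open>From here on \<open>Psi\<close> ignores the dropped constant; the
        inhomogeneous terms are q-th powers that cancel by induction.\<close>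
      then have "pairing (Suc m) 0 (orbit r) = - Psi m (iota r / iota f)" by (rule Suc.IH)
      then show "pairing (Suc (Suc m)) 0 (orbit (shift_mod r)) + Psi (Suc m) (iota (shift_mod r) / iota f) =
          kT * (pairing (Suc (Suc m)) 0 (orbit r) + Psi (Suc m) (iota r / iota f))"
        unfolding rec iota_shift_mod_divide Psi_diff_const Psi_kT
        by (simp add: frob_minus distrib_left)
    qed (use \<open>degree f = Suc e\<close> Suc.prems in auto)
    then show ?case by (simp add: eq_neg_iff_add_eq_0)
  qed
qed

section \<open>Reduction of the dual sums to the pairing\<close>

lemma estar_sums:
  "(\<lambda>j. fls_const (Res (kT ^ j * x)) * alpha Ttil j) sums estar Ttil x"
  unfolding estar_def
proof (intro summable_sums summable_fls)
  fix k
  show "eventually (\<lambda>j. ord_ge k (fls_const (Res (kT ^ j * x)) * alpha Ttil j)) sequentially"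
    using eventually_ge_at_top[of "nat k"]
  proof eventually_elim
    case (elim j)
    have "j < CARD('a) ^ j" by (rule power_gt_expt) (use card_gt_1[where 'a = 'a] in simp)
    with elim have "k \<le> int (CARD('a) ^ j)" by linarith
    then show ?case by (intro ord_ge_mult0 ord_ge_const ord_ge_mono[OF ord_ge_alpha])
  qed
qed

text \<open>In the expansion of \<open>estar\<close>, the residues Res(a_i T^j / f) are the
  coordinates of T^j in the basis b_i of A / f, so linearity and periodicity of e reassemble e(T^j a
  / f) at index j.\<close>

lemma dual_sum_eq_pairing:
  assumes dual: "f_dual f as bs"
  shows "(\<Sum>i=1..degree f. estar Ttil (iota (as i) / iota f) ^ (CARD('a) ^ m) *
             ee Ttil (iota (bs i * a) / iota f) ^ (CARD('a) ^ n)) = pairing m n (orbit a)"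
proof -
  let ?q = "CARD('a)" and ?I = "{1..degree f}"
  let ?c = "\<lambda>j i. Res (iota (as i * monom 1 j) / iota f)"
  let ?y = "\<lambda>i. ee Ttil (iota (bs i * a) / iota f)"
  have "(\<lambda>j. fls_const (?c j i) * alpha Ttil j ^ (?q ^ m) * ?y i ^ (?q ^ n)) sums
      (estar Ttil (iota (as i) / iota f) ^ (?q ^ m) * ?y i ^ (?q ^ n))" for i
  proof -
    have eq: "Res (kT ^ j * (iota (as i) / iota f)) = ?c j i" for j
      by (simp add: mult.commute)
    show ?thesis
      using sums_fls_mult[OF sums_frob[OF estar_sums[of "iota (as i) / iota f"], of m], of "?y i ^ (?q ^ n)"]
      unfolding eq by (simp add: power_mult_distrib frob_const_pow mult_ac)
  qed
  then have "(\<lambda>j. \<Sum>i\<in>?I. fls_const (?c j i) * alpha Ttil j ^ (?q ^ m) * ?y i ^ (?q ^ n)) sums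
      (\<Sum>i\<in>?I. estar Ttil (iota (as i) / iota f) ^ (?q ^ m) * ?y i ^ (?q ^ n))"
    by (rule sums_sum)
  moreover have "(\<Sum>i\<in>?I. fls_const (?c j i) * alpha Ttil j ^ (?q ^ m) * ?y i ^ (?q ^ n)) =
      alpha Ttil j ^ (?q ^ m) * orbit a j ^ (?q ^ n)" for j
  proof -
    let ?s = "\<Sum>i\<in>?I. smult (?c j i) (bs i)"
    \<comment> \<open>Residues lie in F_q and equal their own q^n-th powers, so the whole sum over i
      fits under one Frobenius power.\<close>
    have "(\<Sum>i\<in>?I. fls_const (?c j i) * alpha Ttil j ^ (?q ^ m) * ?y i ^ (?q ^ n)) =
        alpha Ttil j ^ (?q ^ m) * (\<Sum>i\<in>?I. fls_const (?c j i) * ?y i) ^ (?q ^ n)"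
      by (simp add: frob_sum_pow power_mult_distrib frob_const_pow sum_distrib_left mult_ac)
    also have "(\<Sum>i\<in>?I. fls_const (?c j i) * ?y i) = orbit (?s * a) 0"
      by (simp add: orbit_def sum_distrib_right sum_divide_distrib ee_sum mult.assoc
            flip: ee_const_mult times_divide_eq_right)
    also have "orbit (?s * a) = orbit (monom 1 j * a)"
      using f_dual_expand[OF monic dual, of "monom 1 j"]
      by (intro orbit_cong[symmetric]) (simp flip: left_diff_distrib)
    also have "\<dots> 0 = orbit a j" by (rule orbit_monom_mult)
    finally show ?thesis .
  qed
  ultimately have "(\<lambda>j. alpha Ttil j ^ (?q ^ m) * orbit a j ^ (?q ^ n)) sums
      (\<Sum>i\<in>?I. estar Ttil (iota (as i) / iota f) ^ (?q ^ m) * ?y i ^ (?q ^ n))"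
    by (simp only:)
  then show ?thesis using pairing_sums[OF carlitz_orbit] by (rule sums_unique2)
qed

end

theorem theorem5:
  fixes f a :: "'a::{finite,field} poly"
    and as bs :: "nat \<Rightarrow> 'a poly"
    and Ttil :: "'a fls"
  assumes Ttil: "Ttil ^ (CARD('a) - 1) = - kT"
    and monic_f: "lead_coeff f = 1"
    and dual: "f_dual f as bs"
    and deg_a: "a = 0 \<or> degree a < degree f"
  shows "(\<forall>N::nat.
            (\<Sum>i=1..degree f. estar Ttil (iota (as i) / iota f) ^ (CARD('a) ^ (N + 1))
                               * ee Ttil (iota (bs i * a) / iota f))
            = - Psi N (iota a / iota f))
       \<and> (lead_coeff a = 1 \<longrightarrow>
            (\<Sum>i=1..degree f. estar Ttil (iota (as i) / iota f)
                               * ee Ttil (iota (bs i * a) / iota f) ^ (CARD('a) ^ (degree f - degree a - 1)))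
            = 1)"
proof -
  interpret carlitz_modulus Ttil f by unfold_locales (fact Ttil monic_f)+
  have a: "a \<in> polys_below (degree f)" using deg_a by (simp add: polys_below_def)
  have "(\<Sum>i=1..degree f. estar Ttil (iota (as i) / iota f) ^ (CARD('a) ^ (N + 1))
      * ee Ttil (iota (bs i * a) / iota f)) = - Psi N (iota a / iota f)" for N
    using dual_sum_eq_pairing[OF dual, of "N + 1" a 0] pairing_orbit_eq_Psi[OF a, of N]
    by (simp only: power_0 power_one_right Suc_eq_plus1)
  moreover have "(\<Sum>i=1..degree f. estar Ttil (iota (as i) / iota f)
      * ee Ttil (iota (bs i * a) / iota f) ^ (CARD('a) ^ (degree f - degree a - 1))) = 1"
    if lead: "lead_coeff a = 1"
  proof -
    let ?n = "degree f - degree a - 1"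
    \<comment> \<open>A monic \<open>a\<close> is nonzero, so the degree bound applies and the
      subtraction in \<open>?n\<close> is not truncated.\<close>
    have "degree a < degree f" using deg_a lead by auto
    then have "pairing 0 ?n (orbit a) = fls_const (coeff a (degree a))"
      by (intro pairing_orbit_eq_coeff) (auto simp: polys_below_def)
    with dual_sum_eq_pairing[OF dual, of 0 a ?n] lead show ?thesis
      by (simp only: power_0 power_one_right fls_const_1)
  qed
  ultimately show ?thesis by blast
qed

end
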